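(* Let $u=u(x,y,t)$ be a solution of the dKP equation $(u_t-uu_x)_x=u_{yy}$ with $u_x\neq0$. Then the metric $$g=\frac{u_x}{2}\big(\mathrm{d}y^2-4\,\mathrm{d}x\,\mathrm{d}t-4u\,\mathrm{d}t^2\big)-\frac{2}{u_x}\Big(\mathrm{d}z-\frac{u_x\,\mathrm{d}y}{2}-u_y\,\mathrm{d}t\Big)^2$$ in the four coordinates $(x,y,t,z)$ is hyper-K\"ahler.
   Context: Here "hyper-K\"ahler" is used for real metrics of signature $(++--)$ (where it is often called pseudo-hyper-K\"ahler) or for holomorphic metrics: the metric $g$ admits three endomorphisms $I,J,K$ of the (complexified) tangent bundle satisfying the quaternion algebra ($I^2=J^2=K^2=-1$, $IJ=K$, etc.; in signature $(++--)$ one of them is real and two are purely imaginary), each orthogonal with respect to $g$, such that the associated two-forms $g(X,IY)$, $g(X,JY)$, $g(X,KY)$ are all closed. Products of one-forms in the metric are symmetric products. *)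

theory Defs
  imports "HOL-Analysis.Analysis"
begin

text \<open>
  The scalar type \<open>'a\<close> below is \<open>real\<close> (smooth real metrics) or \<open>complex\<close> (holomorphic metrics).
  If \<open>f\<close> is holomorphic, its Frechet derivative is complex linear, so \<open>pd i f\<close> is then the
  complex partial derivative.
\<close>

definition pd ::
  "'n::finite \<Rightarrow> ('a::real_normed_field ^ 'n \<Rightarrow> 'b::real_normed_vector) \<Rightarrow> 'a ^ 'n \<Rightarrow> 'b" where
  "pd i f p = frechet_derivative f (at p) (axis i 1)"

text \<open>C-infinity on an open set: every iterated partial derivative is differentiable.\<close>

definition smooth_on :: "(real ^ 'n::finite) set \<Rightarrow> (real ^ 'n \<Rightarrow> 'b::real_normed_vector) \<Rightarrow> bool" where
  "smooth_on S f \<longleftrightarrow> (\<forall>js. \<forall>p\<in>S. foldr pd js f differentiable at p)"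

definition hol_on :: "(complex ^ 'n::finite) set \<Rightarrow> (complex ^ 'n \<Rightarrow> complex) \<Rightarrow> bool" where
  "hol_on S f \<longleftrightarrow>
     (\<forall>p\<in>S. \<exists>D. (f has_derivative D) (at p) \<and> (\<forall>c v. D (c *s v) = c * D v))"


text \<open>
  Tensors on a domain of 4-space are given by their component matrices in the coordinate frame.
  For a metric matrix \<open>G\<close> and an endomorphism matrix \<open>A\<close>, the two-form \<open>g(X, A Y)\<close> has matrix
  \<open>G ** A\<close>. The cyclic sum in \<open>closed_form\<close> gives the components of the exterior derivative of a
  skew-symmetric matrix; skewness of \<open>G ** A\<close> follows from orthogonality and \<open>A ** A = - mat 1\<close>.
\<close>

definition closed_form ::
  "('a::real_normed_field ^ 4) set \<Rightarrow> ('a ^ 4 \<Rightarrow> complex ^ 4 ^ 4) \<Rightarrow> bool" where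
  "closed_form M w \<longleftrightarrow>
     (\<forall>p\<in>M. \<forall>i j k.
        pd i (\<lambda>q. w q $ j $ k) p + pd j (\<lambda>q. w q $ k $ i) p + pd k (\<lambda>q. w q $ i $ j) p = 0)"

definition orthogonal_endo :: "complex ^ 4 ^ 4 \<Rightarrow> complex ^ 4 ^ 4 \<Rightarrow> bool" where
  "orthogonal_endo G A \<longleftrightarrow> transpose A ** G ** A = G"

definition quaternionic :: "complex ^ 4 ^ 4 \<Rightarrow> complex ^ 4 ^ 4 \<Rightarrow> complex ^ 4 ^ 4 \<Rightarrow> bool" where
  "quaternionic I J K \<longleftrightarrow>
     I ** I = - mat 1 \<and> J ** J = - mat 1 \<and> K ** K = - mat 1 \<and>
     I ** J = K \<and> J ** K = I \<and> K ** I = J \<and>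
     J ** I = - K \<and> K ** J = - I \<and> I ** K = - J"

text \<open>\<open>reg\<close> is the regularity required of the components of the endomorphism fields.\<close>

definition hyperkaehler_triple ::
  "(('a::real_normed_field ^ 4 \<Rightarrow> complex) \<Rightarrow> bool) \<Rightarrow> ('a ^ 4) set \<Rightarrow> ('a ^ 4 \<Rightarrow> complex ^ 4 ^ 4) \<Rightarrow>
   ('a ^ 4 \<Rightarrow> complex ^ 4 ^ 4) \<Rightarrow> ('a ^ 4 \<Rightarrow> complex ^ 4 ^ 4) \<Rightarrow> ('a ^ 4 \<Rightarrow> complex ^ 4 ^ 4) \<Rightarrow> bool" where
  "hyperkaehler_triple reg M G I J K \<longleftrightarrow>
     (\<forall>p\<in>M. quaternionic (I p) (J p) (K p)) \<and>
     (\<forall>A\<in>{I, J, K}.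
        (\<forall>i j. reg (\<lambda>p. A p $ i $ j)) \<and>
        (\<forall>p\<in>M. orthogonal_endo (G p) (A p)) \<and>
        closed_form M (\<lambda>p. G p ** A p))"

definition neutral_signature :: "real ^ 4 ^ 4 \<Rightarrow> bool" where
  "neutral_signature G \<longleftrightarrow>
     (\<exists>P :: real ^ 4 ^ 4. invertible P \<and>
        transpose P ** G ** P =
          (\<chi> i j. if i = j then (if i = 1 \<or> i = 2 then 1 else - 1) else 0))"

text \<open>
  The endomorphisms act on the complexified tangent bundle; one is real and two are purely
  imaginary. As the quaternion relations are invariant under cyclic permutation of \<open>(I, J, K)\<close>,
  the real one may be called \<open>I\<close>.
\<close>

definition hyperkaehler_real :: "(real ^ 4) set \<Rightarrow> (real ^ 4 \<Rightarrow> real ^ 4 ^ 4) \<Rightarrow> bool" where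
  "hyperkaehler_real M g \<longleftrightarrow>
     open M \<and>
     (\<forall>i j. smooth_on M (\<lambda>p. g p $ i $ j)) \<and>
     (\<forall>p\<in>M. transpose (g p) = g p \<and> neutral_signature (g p)) \<and>
     (\<exists>I J K. hyperkaehler_triple (smooth_on M) M (\<lambda>p. map_matrix complex_of_real (g p)) I J K \<and>
        (\<forall>p\<in>M. \<forall>i j. I p $ i $ j \<in> \<real> \<and> Re (J p $ i $ j) = 0 \<and> Re (K p $ i $ j) = 0))"

definition hyperkaehler_hol :: "(complex ^ 4) set \<Rightarrow> (complex ^ 4 \<Rightarrow> complex ^ 4 ^ 4) \<Rightarrow> bool" where
  "hyperkaehler_hol M g \<longleftrightarrow>
     open M \<and>
     (\<forall>i j. hol_on M (\<lambda>p. g p $ i $ j)) \<and>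
     (\<forall>p\<in>M. transpose (g p) = g p \<and> invertible (g p)) \<and>
     (\<exists>I J K. hyperkaehler_triple (hol_on M) M g I J K)"


text \<open>Coordinates are ordered \<open>(x, y, t)\<close> on 3-space and \<open>(x, y, t, z)\<close> on 4-space.\<close>

definition dKP_solution :: "('a::real_normed_field ^ 3) set \<Rightarrow> ('a ^ 3 \<Rightarrow> 'a) \<Rightarrow> bool" where
  "dKP_solution U u \<longleftrightarrow>
     (\<forall>p\<in>U. pd 1 (\<lambda>q. pd 3 u q - u q * pd 1 u q) p = pd 2 (pd 2 u) p)"

definition base :: "'a::zero ^ 4 \<Rightarrow> 'a ^ 3" where
  "base p = vector [p $ 1, p $ 2, p $ 3]"

text \<open>
  One-forms are given by their components; \<open>sprod a b\<close> is their symmetric product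
  \<open>(a \<otimes> b + b \<otimes> a) / 2\<close>, so that \<open>sprod a a\<close> is the square \<open>a\<^sup>2\<close>.
\<close>

definition sprod :: "'a::field ^ 4 \<Rightarrow> 'a ^ 4 \<Rightarrow> 'a ^ 4 ^ 4" where
  "sprod a b = (\<chi> i j. (a $ i * b $ j + b $ i * a $ j) / 2)"

definition dKP_metric :: "('a::real_normed_field ^ 3 \<Rightarrow> 'a) \<Rightarrow> 'a ^ 4 \<Rightarrow> 'a ^ 4 ^ 4" where
  "dKP_metric u p =
     (let dx = axis 1 1; dy = axis 2 1; dt = axis 3 1; dz = axis 4 1;
          v = u (base p); vx = pd 1 u (base p); vy = pd 2 u (base p);
          \<theta> = dz - (vx / 2) *s dy - vy *s dt
      in \<chi> i j. vx / 2 * (sprod dy dy $ i $ j - 4 * sprod dx dt $ i $ j - 4 * v * sprod dt dt $ i $ j)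
                - 2 / vx * sprod \<theta> \<theta> $ i $ j)"

end

theory Submission
  imports Defs "HOL-Complex_Analysis.Cauchy_Integral_Formula"
begin

text \<open>
  Write \<open>f = u\<close>, \<open>a = u\<^sub>x\<close>, \<open>b = u\<^sub>y\<close>. Factoring the difference of the two squares in \<open>g\<close> gives
  \<open>g = 2 (e\<^sub>1 e\<^sub>2 - e\<^sub>3 e\<^sub>4)\<close> for the null coframe

  \<open>e\<^sub>1 = dz - b dt\<close>, \<open>e\<^sub>2 = dy + (b / a + z) dt - dz / a\<close>, \<open>e\<^sub>3 = dt\<close>,
  \<open>e\<^sub>4 = a dx + (a f - z b) dt + z dz\<close>.

  In this frame the two-forms of one duality are spanned by
  \<open>\<Sigma>\<^sub>1 = e\<^sub>1 \<and> e\<^sub>3\<close>, \<open>\<Sigma>\<^sub>2 = e\<^sub>2 \<and> e\<^sub>4\<close> and \<open>\<Sigma>\<^sub>3 = e\<^sub>1 \<and> e\<^sub>2 - e\<^sub>3 \<and> e\<^sub>4\<close>. Raising an index, they become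
  endomorphisms with constant matrices in the frame, and \<open>\<Sigma>\<^sub>2 - \<Sigma>\<^sub>1\<close>, \<open>\<i> (\<Sigma>\<^sub>1 + \<Sigma>\<^sub>2)\<close>, \<open>- \<i> \<Sigma>\<^sub>3\<close>
  correspond to quaternion units \<open>I\<close>, \<open>J\<close>, \<open>K\<close>. So the quaternion relations, orthogonality, the
  reality conditions and the signature are statements about constant matrices, transported by the
  frame. Only closedness involves the equation: \<open>\<Sigma>\<^sub>1 = dz \<and> dt\<close> and
  \<open>\<Sigma>\<^sub>3 = d (z dy + u dt + z\<^sup>2 dt)\<close> are closed for every \<open>u\<close>, while \<open>d \<Sigma>\<^sub>2\<close> is a multiple of
  \<open>dx \<and> dy \<and> dt\<close> whose coefficient vanishes exactly when \<open>u\<close> solves the dKP equation.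

  The \<open>z\<close>-dependence of the coframe is the point of the construction. The terms with \<open>z\<close> are a null
  rotation \<open>e\<^sub>2 \<mapsto> e\<^sub>2 + z e\<^sub>3\<close>, \<open>e\<^sub>4 \<mapsto> e\<^sub>4 + z e\<^sub>1\<close>, which does not change \<open>g\<close>. Without it
  \<open>d \<Sigma>\<^sub>2\<close> has the additional term \<open>- du \<and> dz \<and> dt\<close>: the Killing field \<open>\<partial>\<^sub>z\<close> preserves \<open>g\<close>, but it acts on
  the hyper-Kaehler forms by a nilpotent rotation.

  Two facts of analysis enter. The closedness computation uses
  \<open>u\<^sub>x\<^sub>y = u\<^sub>y\<^sub>x\<close> and \<open>u\<^sub>x\<^sub>t = u\<^sub>t\<^sub>x\<close> (lemma \<open>pd_commute\<close>). And in the holomorphic case, where a solution is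
  only known to be complex differentiable, its partial derivatives must be shown to be
  holomorphic as well (lemma \<open>hol_on_pd\<close>), which follows from Cauchy's integral formula in one
  variable. The common part of the real and the holomorphic case is lemma \<open>hyperkaehler_tripleI\<close>.
\<close>

section \<open>Partial derivatives\<close>

lemma pd_eqI:
  assumes "(f has_derivative D) (at p)"
  shows "pd i f p = D (axis i 1)"
  using frechet_derivative_at[OF assms] by (simp add: pd_def)

lemma pd_const: "pd i (\<lambda>q. c) p = 0"
  by (simp add: pd_def)

lemma pd_cong:
  assumes "open S" "p \<in> S" "\<And>q. q \<in> S \<Longrightarrow> f q = g q"
  shows "pd i f p = pd i g p"
proof -
  have "(f has_derivative D) (at p) \<longleftrightarrow> (g has_derivative D) (at p)" for D
    using has_derivative_transform_within_open[OF _ assms(1,2)] assms(3) by metis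
  then show ?thesis by (simp add: pd_def frechet_derivative_def)
qed

lemma pd_add:
  assumes "f differentiable at p" "g differentiable at p"
  shows "pd i (\<lambda>q. f q + g q) p = pd i f p + pd i g p"
  using pd_eqI[OF has_derivative_add[OF assms[unfolded frechet_derivative_works]]]
  by (simp add: pd_def)

lemma pd_diff:
  assumes "f differentiable at p" "g differentiable at p"
  shows "pd i (\<lambda>q. f q - g q) p = pd i f p - pd i g p"
  using pd_eqI[OF has_derivative_diff[OF assms[unfolded frechet_derivative_works]]]
  by (simp add: pd_def)

lemma pd_minus:
  assumes "f differentiable at p"
  shows "pd i (\<lambda>q. - f q) p = - pd i f p"
  using pd_eqI[OF has_derivative_minus[OF assms[unfolded frechet_derivative_works]]]
  by (simp add: pd_def)

lemma pd_mult:
  fixes f g :: "'a::real_normed_field ^ 'n::finite \<Rightarrow> 'b::real_normed_field"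
  assumes "f differentiable at p" "g differentiable at p"
  shows "pd i (\<lambda>q. f q * g q) p = f p * pd i g p + pd i f p * g p"
  using pd_eqI[OF has_derivative_mult[OF assms[unfolded frechet_derivative_works]]]
  by (simp add: pd_def)

lemma pd_inverse:
  fixes f :: "'a::real_normed_field ^ 'n::finite \<Rightarrow> 'b::real_normed_field"
  assumes "f differentiable at p" "f p \<noteq> 0"
  shows "pd i (\<lambda>q. inverse (f q)) p = - (inverse (f p) * pd i f p * inverse (f p))"
  using pd_eqI[OF Deriv.has_derivative_inverse[OF assms(2) assms(1)[unfolded frechet_derivative_works]]]
  by (simp add: pd_def)

lemma pd_bounded_linear:
  assumes "bounded_linear L" "f differentiable at p"
  shows "pd i (\<lambda>q. L (f q)) p = L (pd i f p)"
  using pd_eqI[OF bounded_linear.has_derivative[OF assms(1) assms(2)[unfolded frechet_derivative_works]]]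
  by (simp add: pd_def)

lemma has_derivative_nth: "((\<lambda>q. q $ k) has_derivative (\<lambda>h. h $ k)) (at p)"
  by (rule bounded_linear_imp_has_derivative[OF bounded_linear_vec_nth])

lemma pd_nth: "pd i (\<lambda>q. q $ k) p = (if i = k then 1 else 0)"
  by (simp add: pd_eqI[OF has_derivative_nth] axis_def)

lemma has_derivative_base:
  fixes p :: "'a::{real_normed_field,euclidean_space} ^ 4"
  shows "(base has_derivative base) (at p)"
proof -
  have "linear (base :: 'a ^ 4 \<Rightarrow> 'a ^ 3)"
    by (rule linearI) (auto simp: base_def vec_eq_iff forall_3)
  then show ?thesis
    by (simp add: bounded_linear_imp_has_derivative linear_conv_bounded_linear)
qed

lemma has_derivative_compose_base:
  fixes p :: "'a::{real_normed_field,euclidean_space} ^ 4"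
  assumes "(f has_derivative D) (at (base p))"
  shows "((\<lambda>q. f (base q)) has_derivative (\<lambda>h. D (base h))) (at p)"
  using has_derivative_compose[OF has_derivative_base assms] .

lemma differentiable_compose_base:
  fixes p :: "'a::{real_normed_field,euclidean_space} ^ 4"
  assumes "f differentiable at (base p)"
  shows "(\<lambda>q. f (base q)) differentiable at p"
  using has_derivative_compose_base assms unfolding differentiable_def by blast

lemma pd_compose_base:
  fixes p :: "'a::{real_normed_field,euclidean_space} ^ 4"
  assumes "f differentiable at (base p)"
  shows "pd 1 (\<lambda>q. f (base q)) p = pd 1 f (base p)"
    "pd 2 (\<lambda>q. f (base q)) p = pd 2 f (base p)"
    "pd 3 (\<lambda>q. f (base q)) p = pd 3 f (base p)"
    "pd 4 (\<lambda>q. f (base q)) p = 0"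
proof -
  have ax: "base (axis 1 1 :: 'a^4) = axis 1 1" "base (axis 2 1 :: 'a^4) = axis 2 1"
    "base (axis 3 1 :: 'a^4) = axis 3 1" "base (axis 4 1 :: 'a^4) = 0"
    by (simp_all add: base_def vec_eq_iff forall_3 axis_def)
  have d: "(f has_derivative frechet_derivative f (at (base p))) (at (base p))"
    using assms frechet_derivative_works by blast
  have "pd i (\<lambda>q. f (base q)) p = frechet_derivative f (at (base p)) (base (axis i 1))" for i
    by (rule pd_eqI[OF has_derivative_compose_base[OF d]])
  moreover have "frechet_derivative f (at (base p)) 0 = 0"
    using linear_0[OF linear_frechet_derivative[OF assms]] .
  ultimately show "pd 1 (\<lambda>q. f (base q)) p = pd 1 f (base p)"
    "pd 2 (\<lambda>q. f (base q)) p = pd 2 f (base p)"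
    "pd 3 (\<lambda>q. f (base q)) p = pd 3 f (base p)"
    "pd 4 (\<lambda>q. f (base q)) p = 0"
    by (simp_all add: ax pd_def)
qed

lemma open_vimage_base:
  fixes U :: "('a::{real_normed_field,euclidean_space} ^ 3) set"
  assumes "open U" shows "open (base -` U)"
proof -
  have "continuous_on UNIV (base :: 'a ^ 4 \<Rightarrow> 'a ^ 3)"
    using has_derivative_base has_derivative_continuous
    by (metis continuous_at_imp_continuous_on)
  then show ?thesis using assms open_vimage by blast
qed

section \<open>Symmetry of second derivatives\<close>

text \<open>
  The second difference over a parallelogram with sides \<open>h a\<close>, \<open>h b\<close> is a difference in the direction
  \<open>a\<close> of a first difference in the direction \<open>b\<close>. The mean value theorem turns the former into a
  derivative \<open>F x a\<close>, and differentiability of \<open>F x a\<close> at \<open>p\<close> controls the latter.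
\<close>

lemma second_difference_tendsto:
  fixes f :: "'v::real_normed_vector \<Rightarrow> real"
  assumes S: "open S" "p \<in> S"
    and F: "\<And>x. x \<in> S \<Longrightarrow> (f has_derivative F x) (at x)"
    and L: "((\<lambda>x. F x a) has_derivative L) (at p)"
  shows "((\<lambda>h. (f (p + h *\<^sub>R a + h *\<^sub>R b) - f (p + h *\<^sub>R a) - f (p + h *\<^sub>R b) + f p) / h\<^sup>2)
           \<longlongrightarrow> L b) (at_right 0)"
proof (rule tendstoI)
  fix e :: real assume e: "e > 0"
  \<comment> \<open>\<open>N h\<close> bounds the distances from \<open>p\<close> of the two points at which \<open>F\<close> is compared; the summand 1 keeps it positive.\<close>
  define N where "N = 2 * norm a + norm b + 1"
  have N: "N > 0" by (simp add: N_def add_nonneg_pos)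
  have "e / N > 0" using e N by simp
  then obtain d1 where d1: "d1 > 0" and
    Ld: "\<And>y. norm (y - p) < d1 \<Longrightarrow> norm (F y a - F p a - L (y - p)) \<le> e / N * norm (y - p)"
    using L unfolding has_derivative_at_alt by blast
  obtain d2 where d2: "d2 > 0" "ball p d2 \<subseteq> S" using S openE by blast
  define d where "d = min d1 d2"
  have d: "d > 0" using d1 d2 by (simp add: d_def)
  have linL: "linear L" using L has_derivative_linear by blast
  have near: "norm (s *\<^sub>R a + t *\<^sub>R b) < d" "norm (s *\<^sub>R a + t *\<^sub>R b) \<le> h * (norm a + norm b)"
    if "0 \<le> s" "s \<le> h" "0 \<le> t" "t \<le> h" "h < d / N" for s t h
  proof -
    have "norm (s *\<^sub>R a + t *\<^sub>R b) \<le> s * norm a + t * norm b"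
      using norm_triangle_ineq[of "s *\<^sub>R a" "t *\<^sub>R b"] that by simp
    also have "\<dots> \<le> h * norm a + h * norm b"
      by (intro add_mono mult_right_mono) (use that in auto)
    finally show 1: "norm (s *\<^sub>R a + t *\<^sub>R b) \<le> h * (norm a + norm b)" by (simp add: algebra_simps)
    also have "\<dots> \<le> h * N" by (rule mult_left_mono) (use that in \<open>auto simp: N_def\<close>)
    also have "\<dots> < d" using that N by (simp add: field_simps)
    finally show "norm (s *\<^sub>R a + t *\<^sub>R b) < d" .
  qed
  have main: "dist ((f (p + h *\<^sub>R a + h *\<^sub>R b) - f (p + h *\<^sub>R a) - f (p + h *\<^sub>R b) + f p) / h\<^sup>2) (L b) < e"
    if h: "0 < h" "h < d / N" for h
  proof -
    define g where "g = (\<lambda>s. f (p + (s *\<^sub>R a + h *\<^sub>R b)) - f (p + (s *\<^sub>R a + 0 *\<^sub>R b)))"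
    define g' where "g' = (\<lambda>s. F (p + (s *\<^sub>R a + h *\<^sub>R b)) a - F (p + (s *\<^sub>R a + 0 *\<^sub>R b)) a)"
    have inS: "p + (s *\<^sub>R a + t *\<^sub>R b) \<in> S" if "0 \<le> s" "s \<le> h" "0 \<le> t" "t \<le> h" for s t
    proof -
      have "dist p (p + v) = norm v" for v
        by (metis add_diff_cancel_left' dist_commute dist_norm)
      then have "p + (s *\<^sub>R a + t *\<^sub>R b) \<in> ball p d2"
        using near(1)[OF that h(2)] by (simp add: d_def)
      then show ?thesis using d2 by blast
    qed
    have der: "((\<lambda>s. f (p + (s *\<^sub>R a + t *\<^sub>R b))) has_real_derivative F (p + (s *\<^sub>R a + t *\<^sub>R b)) a) (at s)"
      if "0 \<le> s" "s \<le> h" "0 \<le> t" "t \<le> h" for s t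
    proof -
      note D = F[OF inS[OF that]]
      have "((\<lambda>s. p + (s *\<^sub>R a + t *\<^sub>R b)) has_derivative (\<lambda>k. k *\<^sub>R a)) (at s)"
        by (auto intro!: derivative_eq_intros)
      from has_derivative_compose[OF this D]
      have "((\<lambda>s. f (p + (s *\<^sub>R a + t *\<^sub>R b))) has_derivative (\<lambda>k. F (p + (s *\<^sub>R a + t *\<^sub>R b)) (k *\<^sub>R a))) (at s)" .
      moreover have "F (p + (s *\<^sub>R a + t *\<^sub>R b)) (k *\<^sub>R a) = F (p + (s *\<^sub>R a + t *\<^sub>R b)) a * k" for k
        using linear_scale[OF has_derivative_linear[OF D]] by simp
      ultimately show ?thesis by (simp add: has_field_derivative_def)
    qed
    have "\<And>s. 0 \<le> s \<Longrightarrow> s \<le> h \<Longrightarrow> (g has_real_derivative g' s) (at s)"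
      unfolding g_def g'_def by (intro DERIV_diff der) (use h in auto)
    from MVT2[OF h(1) this] obtain x where x: "0 < x" "x < h" "g h - g 0 = (h - 0) * g' x" by blast
    let ?y1 = "x *\<^sub>R a + h *\<^sub>R b" and ?y0 = "x *\<^sub>R a + 0 *\<^sub>R b"
    have b1: "norm (F (p + ?y1) a - F p a - L ?y1) \<le> e / N * norm ?y1"
      using Ld[of "p + ?y1"] near(1)[of x h h] x h by (simp add: d_def)
    have b0: "norm (F (p + ?y0) a - F p a - L ?y0) \<le> e / N * norm ?y0"
      using Ld[of "p + ?y0"] near(1)[of x h 0] x h by (simp add: d_def)
    have "L ?y1 - L ?y0 = h * L b"
      using linL by (simp add: linear_add linear_scale)
    then have "\<bar>g' x - h * L b\<bar> \<le> e / N * norm ?y1 + e / N * norm ?y0"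
      using b1 b0 unfolding g'_def real_norm_def by linarith
    also have "\<dots> = e / N * (norm ?y1 + norm ?y0)" by (simp add: algebra_simps)
    also have "\<dots> \<le> e / N * (h * (2 * norm a + norm b))"
    proof (rule mult_left_mono)
      have "norm ?y1 \<le> h * (norm a + norm b)" using near(2)[of x h h] x h by simp
      moreover have "norm ?y0 \<le> h * norm a" using x by (simp add: mult_right_mono)
      ultimately show "norm ?y1 + norm ?y0 \<le> h * (2 * norm a + norm b)" by (simp add: algebra_simps)
    qed (use e N in auto)
    also have "\<dots> < e / N * (h * N)"
      by (rule mult_strict_left_mono) (use e N h in \<open>auto simp: N_def\<close>)
    also have "\<dots> = e * h" using N by simp
    finally have bound: "\<bar>g' x - h * L b\<bar> < e * h" .
    have "f (p + h *\<^sub>R a + h *\<^sub>R b) - f (p + h *\<^sub>R a) - f (p + h *\<^sub>R b) + f p = h * g' x"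
      using x(3) by (simp add: g_def add.assoc)
    then have "dist ((f (p + h *\<^sub>R a + h *\<^sub>R b) - f (p + h *\<^sub>R a) - f (p + h *\<^sub>R b) + f p) / h\<^sup>2) (L b)
        = \<bar>(g' x - h * L b) / h\<bar>"
      using h by (simp add: dist_norm power2_eq_square field_simps)
    also have "\<dots> < e" using bound h by (simp add: abs_divide field_simps)
    finally show ?thesis .
  qed
  show "\<forall>\<^sub>F h in at_right 0. dist ((f (p + h *\<^sub>R a + h *\<^sub>R b) - f (p + h *\<^sub>R a) - f (p + h *\<^sub>R b) + f p) / h\<^sup>2) (L b) < e"
    unfolding eventually_at_right_field using main d N by (intro exI[of _ "d / N"]) auto
qed

text \<open>
  The second difference is symmetric in \<open>a\<close> and \<open>b\<close>, hence so is its limit.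
\<close>

lemma second_derivative_symmetric_real:
  fixes f :: "'v::real_normed_vector \<Rightarrow> real"
  assumes "open S" "p \<in> S"
    and "\<And>x. x \<in> S \<Longrightarrow> (f has_derivative F x) (at x)"
    and "((\<lambda>x. F x a) has_derivative L) (at p)" "((\<lambda>x. F x b) has_derivative L') (at p)"
  shows "L b = L' a"
proof -
  have "((\<lambda>h. (f (p + h *\<^sub>R a + h *\<^sub>R b) - f (p + h *\<^sub>R a) - f (p + h *\<^sub>R b) + f p) / h\<^sup>2)
           \<longlongrightarrow> L' a) (at_right 0)"
    using second_difference_tendsto[OF assms(1-3,5), of a]
    by (simp add: algebra_simps)
  with second_difference_tendsto[OF assms(1-4), of b] show ?thesis
    by (intro tendsto_unique[OF trivial_limit_at_right_real])
qed

text \<open>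
  For a complex scalar type \<open>pd i f\<close> is still a real directional derivative, in the direction
  \<open>axis i 1\<close>, so the symmetry of real second derivatives covers the holomorphic case too. Inner
  products reduce vector values to real values.
\<close>

lemma pd_commute:
  fixes f :: "'a::real_normed_field ^ 'n::finite \<Rightarrow> 'b::real_inner"
  assumes S: "open S" "p \<in> S" and f: "\<And>x. x \<in> S \<Longrightarrow> f differentiable at x"
    and i: "pd i f differentiable at p" and j: "pd j f differentiable at p"
  shows "pd i (pd j f) p = pd j (pd i f) p"
proof -
  have "c \<bullet> pd i (pd j f) p = c \<bullet> pd j (pd i f) p" for c
  proof -
    have F: "((\<lambda>x. c \<bullet> f x) has_derivative (\<lambda>h. c \<bullet> frechet_derivative f (at x) h)) (at x)"
      if "x \<in> S" for x
      using f[OF that] by (intro has_derivative_inner_right) (simp add: frechet_derivative_works)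
    have P: "((\<lambda>x. c \<bullet> frechet_derivative f (at x) (axis k 1)) has_derivative
        (\<lambda>h. c \<bullet> frechet_derivative (pd k f) (at p) h)) (at p)"
      if "pd k f differentiable at p" for k
      using that unfolding pd_def[abs_def]
      by (intro has_derivative_inner_right) (simp add: frechet_derivative_works)
    show ?thesis
      using second_derivative_symmetric_real[OF S F P[OF j] P[OF i]] by (simp add: pd_def)
  qed
  then show ?thesis by (meson vector_eq_rdot inner_commute vector_eq_ldot)
qed

section \<open>Smooth functions on open sets\<close>

lemma foldr_pd_cong:
  assumes "open S" "\<And>p. p \<in> S \<Longrightarrow> f p = g p" "p \<in> S"
  shows "foldr pd js f p = foldr pd js g p"
  using assms(3)
proof (induction js arbitrary: p)
  case Nil then show ?case using assms by simp
next
  case (Cons j js)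
  then show ?case using pd_cong[OF assms(1), of p "foldr pd js f" "foldr pd js g" j] by simp
qed

lemma differentiable_cong_open:
  assumes "open S" "p \<in> S" "\<And>q. q \<in> S \<Longrightarrow> f q = g q" "f differentiable at p"
  shows "g differentiable at p"
  using assms has_derivative_transform_within_open unfolding differentiable_def by metis

text \<open>
  Smoothness is the largest property that implies differentiability and passes to partial
  derivatives. Closure properties then need only the first-order differentiation rules, and the
  derivatives need to agree with functions of the class on \<open>S\<close> only.
\<close>

lemma smooth_on_coinduct:
  assumes S: "open S" and "P f"
    and step: "\<And>f. P f \<Longrightarrow> (\<forall>p\<in>S. f differentiable at p) \<and> (\<forall>i. \<exists>g. P g \<and> (\<forall>p\<in>S. pd i f p = g p))"
  shows "smooth_on S f"
proof -
  have "\<forall>p\<in>S. foldr pd js f differentiable at p" for js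
    using \<open>P f\<close>
  proof (induction js arbitrary: f rule: rev_induct)
    case Nil then show ?case using step by auto
  next
    case (snoc i js)
    obtain g where g: "P g" "\<forall>p\<in>S. pd i f p = g p" using step[OF snoc.prems] by blast
    show ?case
    proof
      fix p assume p: "p \<in> S"
      have "foldr pd js g differentiable at p" using snoc.IH[OF g(1)] p by blast
      then show "foldr pd (js @ [i]) f differentiable at p"
        using differentiable_cong_open[OF S p, of "foldr pd js g" "foldr pd js (pd i f)"]
          foldr_pd_cong[OF S, of g "pd i f" _ js] g(2) by auto
    qed
  qed
  then show ?thesis by (simp add: smooth_on_def)
qed

lemma smooth_on_differentiable:
  assumes "smooth_on S f" "p \<in> S" shows "f differentiable at p"
proof -
  have "foldr pd [] f differentiable at p" using assms unfolding smooth_on_def by blast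
  then show ?thesis by simp
qed

lemma smooth_on_pd:
  assumes "smooth_on S f" shows "smooth_on S (pd i f)"
  unfolding smooth_on_def
proof (intro allI ballI)
  fix js p assume "p \<in> S"
  then have "foldr pd (js @ [i]) f differentiable at p" using assms unfolding smooth_on_def by blast
  then show "foldr pd js (pd i f) differentiable at p" by simp
qed

lemma smooth_on_const: "smooth_on S (\<lambda>p. c)"
proof -
  have "foldr pd js (\<lambda>p. c) \<in> range (\<lambda>c p. c)" for js :: "'n::finite list"
    by (induction js) (auto simp: pd_def)
  then show ?thesis unfolding smooth_on_def by (metis (no_types) differentiable_const rangeE)
qed

lemma smooth_on_nth: "open S \<Longrightarrow> smooth_on S (\<lambda>p::real^'n::finite. p $ k)"
  by (rule smooth_on_coinduct[where P = "\<lambda>f. f = (\<lambda>p. p $ k) \<or> (\<exists>c. f = (\<lambda>p. c))"])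
    (auto simp: pd_nth pd_const intro: differentiableI has_derivative_nth)

lemma smooth_on_bounded_linear:
  assumes "open S" "bounded_linear L" "smooth_on S f"
  shows "smooth_on S (\<lambda>p. L (f p))"
proof (rule smooth_on_coinduct[OF assms(1), where P = "\<lambda>h. \<exists>g. smooth_on S g \<and> h = (\<lambda>p. L (g p))"])
  show "\<exists>g. smooth_on S g \<and> (\<lambda>p. L (f p)) = (\<lambda>p. L (g p))" using assms by blast
next
  fix h assume "\<exists>g. smooth_on S g \<and> h = (\<lambda>p. L (g p))"
  then obtain g where g: "smooth_on S g" "h = (\<lambda>p. L (g p))" by blast
  have "h differentiable at p" if "p \<in> S" for p
    using smooth_on_differentiable[OF g(1) that] bounded_linear.has_derivative[OF assms(2)]
    unfolding g(2) differentiable_def by blast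
  moreover have "pd i h p = L (pd i g p)" if "p \<in> S" for p i
    unfolding g(2) by (rule pd_bounded_linear[OF assms(2) smooth_on_differentiable[OF g(1) that]])
  ultimately show "(\<forall>p\<in>S. h differentiable at p) \<and>
      (\<forall>i. \<exists>k. (\<exists>g. smooth_on S g \<and> k = (\<lambda>p. L (g p))) \<and> (\<forall>p\<in>S. pd i h p = k p))"
    using smooth_on_pd[OF g(1)] by blast
qed

lemma smooth_on_compose_base:
  assumes "open U" "smooth_on U f"
  shows "smooth_on (base -` U) (\<lambda>p. f (base p))"
proof (rule smooth_on_coinduct[OF open_vimage_base[OF assms(1)],
      where P = "\<lambda>h. \<exists>g. smooth_on U g \<and> h = (\<lambda>p. g (base p))"])
  show "\<exists>g. smooth_on U g \<and> (\<lambda>p. f (base p)) = (\<lambda>p. g (base p))" using assms by blast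
next
  fix h :: "real^4 \<Rightarrow> 'a" assume "\<exists>g. smooth_on U g \<and> h = (\<lambda>p. g (base p))"
  then obtain g where g: "smooth_on U g" "h = (\<lambda>p. g (base p))" by blast
  have d: "g differentiable at (base p)" if "p \<in> base -` U" for p
    using smooth_on_differentiable[OF g(1)] that by simp
  have "\<exists>k. smooth_on U k \<and> (\<forall>p\<in>base -` U. pd i h p = k (base p))" for i
    using exhaust_4[of i] pd_compose_base[OF d] smooth_on_pd[OF g(1)] smooth_on_const[of U 0]
    unfolding g(2) by (metis (no_types, lifting))
  then show "(\<forall>p\<in>base -` U. h differentiable at p) \<and>
      (\<forall>i. \<exists>k. (\<exists>g. smooth_on U g \<and> k = (\<lambda>p. g (base p))) \<and> (\<forall>p\<in>base -` U. pd i h p = k p))"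
    using differentiable_compose_base[OF d] unfolding g(2) by blast
qed

text \<open>
  The derivatives of products and inverses are again built from smooth functions by sums, products
  and inverses. The class of all functions built in this way is therefore invariant under
  differentiation, as the coinduction principle requires.
\<close>

inductive field_closure :: "(real ^ 'n::finite) set \<Rightarrow> (real ^ 'n \<Rightarrow> 'b::real_normed_field) \<Rightarrow> bool"
  for S where
  smooth: "smooth_on S f \<Longrightarrow> field_closure S f"
| add: "field_closure S f \<Longrightarrow> field_closure S g \<Longrightarrow> field_closure S (\<lambda>p. f p + g p)"
| mult: "field_closure S f \<Longrightarrow> field_closure S g \<Longrightarrow> field_closure S (\<lambda>p. f p * g p)"
| inverse: "field_closure S f \<Longrightarrow> (\<And>p. p \<in> S \<Longrightarrow> f p \<noteq> 0) \<Longrightarrow> field_closure S (\<lambda>p. inverse (f p))"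

lemma field_closure_step:
  assumes "field_closure S f"
  shows "(\<forall>p\<in>S. f differentiable at p) \<and> (\<forall>i. \<exists>g. field_closure S g \<and> (\<forall>p\<in>S. pd i f p = g p))"
  using assms
proof induction
  case (smooth f)
  then show ?case
    using smooth_on_differentiable smooth_on_pd field_closure.smooth by blast
next
  case (add f g)
  have "\<exists>h. field_closure S h \<and> (\<forall>p\<in>S. pd i (\<lambda>p. f p + g p) p = h p)" for i
  proof -
    obtain f' g' where "field_closure S f'" "\<forall>p\<in>S. pd i f p = f' p"
      "field_closure S g'" "\<forall>p\<in>S. pd i g p = g' p" using add.IH by metis
    then show ?thesis using add.IH
      by (intro exI[of _ "\<lambda>p. f' p + g' p"]) (auto simp: pd_add intro: field_closure.add)
  qed
  then show ?case using add.IH by auto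
next
  case (mult f g)
  have "\<exists>h. field_closure S h \<and> (\<forall>p\<in>S. pd i (\<lambda>p. f p * g p) p = h p)" for i
  proof -
    obtain f' g' where "field_closure S f'" "\<forall>p\<in>S. pd i f p = f' p"
      "field_closure S g'" "\<forall>p\<in>S. pd i g p = g' p" using mult.IH by metis
    then show ?thesis using mult.IH mult.hyps
      by (intro exI[of _ "\<lambda>p. f p * g' p + f' p * g p"])
        (auto simp: pd_mult intro!: field_closure.add field_closure.mult)
  qed
  then show ?case using mult.IH by auto
next
  case (inverse f)
  have "\<exists>h. field_closure S h \<and> (\<forall>p\<in>S. pd i (\<lambda>p. inverse (f p)) p = h p)" for i
  proof -
    obtain f' where "field_closure S f'" "\<forall>p\<in>S. pd i f p = f' p" using inverse.IH by metis
    then show ?thesis using inverse.IH inverse.hyps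
      by (intro exI[of _ "\<lambda>p. (- 1) * (inverse (f p) * f' p * inverse (f p))"] conjI
          field_closure.mult field_closure.inverse field_closure.smooth[OF smooth_on_const])
        (auto simp: pd_inverse)
  qed
  then show ?case using inverse.IH inverse.hyps
    by (auto intro: differentiable_inverse)
qed

lemma field_closure_smooth: "open S \<Longrightarrow> field_closure S f \<Longrightarrow> smooth_on S f"
  by (rule smooth_on_coinduct[where P = "field_closure S"]) (auto dest: field_closure_step)

lemma
  fixes f g :: "real ^ 'n::finite \<Rightarrow> 'b::real_normed_field"
  assumes "open S" "smooth_on S f"
  shows smooth_on_add: "smooth_on S g \<Longrightarrow> smooth_on S (\<lambda>p. f p + g p)"
    and smooth_on_mult: "smooth_on S g \<Longrightarrow> smooth_on S (\<lambda>p. f p * g p)"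
    and smooth_on_inverse: "(\<And>p. p \<in> S \<Longrightarrow> f p \<noteq> 0) \<Longrightarrow> smooth_on S (\<lambda>p. inverse (f p))"
  using assms by (auto intro!: field_closure_smooth intro: field_closure.intros)

lemma smooth_on_cong:
  assumes "open S" "\<And>p. p \<in> S \<Longrightarrow> f p = g p" "smooth_on S g"
  shows "smooth_on S f"
  unfolding smooth_on_def
proof (intro allI ballI)
  fix js p assume p: "p \<in> S"
  show "foldr pd js f differentiable at p"
  proof (rule differentiable_cong_open[OF assms(1) p])
    show "foldr pd js g q = foldr pd js f q" if "q \<in> S" for q
      using foldr_pd_cong[OF assms(1), of g f q js] assms(2) that by simp
    show "foldr pd js g differentiable at p" using assms(3) p by (simp add: smooth_on_def)
  qed
qed

section \<open>Holomorphic functions of several variables\<close>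

lemma bounded_linear_axis: "bounded_linear (axis i :: complex \<Rightarrow> complex ^ 'n::finite)"
  by (simp add: linear_conv_bounded_linear[symmetric] linear_iff axis_def vec_eq_iff)

lemma norm_axis: "norm (axis i w :: complex ^ 'n::finite) = norm w"
  by (simp add: norm_vec_def L2_set_def axis_def if_distrib[of norm] if_distrib[of "\<lambda>x. x\<^sup>2"] cong: if_cong)

lemma hol_on_has_derivative:
  assumes "hol_on S f" "q \<in> S"
  shows "(f has_derivative (\<lambda>h. \<Sum>j\<in>UNIV. h $ j * pd j f q)) (at q)"
proof -
  obtain D where D: "(f has_derivative D) (at q)" "\<And>c v. D (c *s v) = c * D v"
    using assms unfolding hol_on_def by blast
  have "D h = (\<Sum>j\<in>UNIV. h $ j * pd j f q)" for h
  proof -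
    have "D h = D (\<Sum>j\<in>UNIV. h $ j *s axis j 1)" by (simp add: basis_expansion)
    also have "\<dots> = (\<Sum>j\<in>UNIV. D (h $ j *s axis j 1))"
      using D(1) by (intro linear_sum has_derivative_linear)
    finally show ?thesis by (simp add: D(2) pd_eqI[OF D(1)])
  qed
  then have "D = (\<lambda>h. \<Sum>j\<in>UNIV. h $ j * pd j f q)" by blast
  with D(1) show ?thesis by simp
qed

lemma hol_on_differentiable: "hol_on S f \<Longrightarrow> q \<in> S \<Longrightarrow> f differentiable at q"
  using hol_on_has_derivative differentiableI by blast

lemma hol_on_continuous_on: "hol_on S f \<Longrightarrow> continuous_on S f"
  by (intro continuous_at_imp_continuous_on ballI has_derivative_continuous)
    (rule hol_on_has_derivative)

definition circle :: "real \<Rightarrow> real \<Rightarrow> complex" where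
  "circle r t = of_real r * exp (2 * of_real pi * \<i> * of_real t)"

lemma norm_circle: "norm (circle r t) = \<bar>r\<bar>"
proof -
  have "circle r t = of_real r * exp (\<i> * of_real (2 * pi * t))"
    by (simp add: circle_def mult_ac)
  then show ?thesis by (simp only: norm_mult norm_exp_i_times norm_of_real)
qed

text \<open>
  Cauchy's formula for the first derivative in the variable \<open>i\<close>, with the other variables fixed. The
  factor \<open>\<gamma>' / (2 \<pi> \<i> \<gamma>\<^sup>2)\<close> of the parametrised contour integral is \<open>1 / \<gamma>\<close>.
\<close>

lemma pd_Cauchy:
  fixes f :: "complex ^ 'n::finite \<Rightarrow> complex"
  assumes f: "hol_on S f" and r: "0 < r" "cball q r \<subseteq> S"
  shows "pd i f q = integral (cbox 0 1) (\<lambda>t. f (q + axis i (circle r t)) / circle r t)"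
proof -
  define \<phi> where "\<phi> w = f (q + axis i w)" for w
  have der: "(\<phi> has_field_derivative pd i f (q + axis i w)) (at w)" if "w \<in> cball 0 r" for w
  proof -
    have "q + axis i w \<in> S" using that r by (auto simp: dist_norm norm_axis)
    note D = hol_on_has_derivative[OF f this]
    have "((\<lambda>w. q + axis i w) has_derivative (\<lambda>k. 0 + axis i k)) (at w)"
      by (intro has_derivative_add has_derivative_const
          bounded_linear_imp_has_derivative bounded_linear_axis)
    from has_derivative_compose[OF this D]
    show ?thesis
      unfolding \<phi>_def has_field_derivative_def
      by (rule has_derivative_eq_rhs)
        (simp add: axis_def fun_eq_iff if_distrib[of "\<lambda>x. x * _"] cong: if_cong)
  qed
  have cont: "continuous_on (cball 0 r) \<phi>"
    using der by (intro continuous_at_imp_continuous_on ballI) (blast intro: DERIV_isCont)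
  have "\<phi> holomorphic_on ball 0 r"
    using der by (intro holomorphic_onI) (meson ball_subset_cball field_differentiable_def
        field_differentiable_at_within subsetD)
  from Cauchy_derivative_integral_circlepath(2)[OF cont this, of 0] r
  have "(\<phi> has_field_derivative 1 / (2 * of_real pi * \<i>) *
      contour_integral (circlepath 0 r) (\<lambda>u. \<phi> u / u\<^sup>2)) (at 0)" by simp
  moreover have "(\<phi> has_field_derivative pd i f q) (at 0)"
    using der[of 0] r by (simp add: linear_0[OF bounded_linear.linear[OF bounded_linear_axis]])
  ultimately have "pd i f q = 1 / (2 * of_real pi * \<i>) *
      contour_integral (circlepath 0 r) (\<lambda>u. \<phi> u / u\<^sup>2)"
    using DERIV_unique by blast
  also have "\<dots> = integral {0..1} (\<lambda>t. 1 / (2 * of_real pi * \<i>) *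
      (\<phi> (circlepath 0 r t) / (circlepath 0 r t)\<^sup>2 * vector_derivative (circlepath 0 r) (at t)))"
    by (simp only: contour_integral_integral integral_mult_right)
  also have "\<dots> = integral {0..1} (\<lambda>t. f (q + axis i (circle r t)) / circle r t)"
  proof (rule integral_cong)
    fix t :: real
    have "vector_derivative (circlepath 0 r) (at t) = 2 * of_real pi * \<i> * circle r t"
      by (simp add: vector_derivative_circlepath circle_def)
    moreover have "circlepath 0 r t = circle r t" by (simp add: circlepath circle_def)
    moreover have "circle r t \<noteq> 0" using norm_circle[of r t] r(1) by auto
    ultimately show "1 / (2 * of_real pi * \<i>) * (\<phi> (circlepath 0 r t) / (circlepath 0 r t)\<^sup>2 *
        vector_derivative (circlepath 0 r) (at t)) = f (q + axis i (circle r t)) / circle r t"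
      by (simp add: \<phi>_def power2_eq_square)
  qed
  finally show ?thesis by simp
qed

lemma continuous_on_translated_circle:
  fixes g :: "complex ^ 'n::finite \<Rightarrow> complex"
  assumes "continuous_on S g" "0 < r" "\<And>q. q \<in> B \<Longrightarrow> cball q r \<subseteq> S"
  shows "continuous_on (B \<times> T) (\<lambda>(q, t). g (q + axis i (circle r t)) / circle r t)"
proof -
  have c: "continuous_on (B \<times> T) (\<lambda>x. circle r (snd x))"
    unfolding circle_def by (intro continuous_intros)
  have "continuous_on (B \<times> T) (\<lambda>x. g (fst x + axis i (circle r (snd x))))"
  proof (rule continuous_on_compose2[OF assms(1)])
    show "continuous_on (B \<times> T) (\<lambda>x. fst x + axis i (circle r (snd x)))"
      by (intro continuous_intros bounded_linear.continuous_on[OF bounded_linear_axis] c)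
    show "(\<lambda>x. fst x + axis i (circle r (snd x))) ` (B \<times> T) \<subseteq> S"
    proof clarsimp
      fix q t assume "q \<in> B"
      then have "q + axis i (circle r t) \<in> cball q r"
        using assms(2) by (simp add: dist_norm norm_axis norm_circle)
      then show "q + axis i (circle r t) \<in> S" using assms(3) \<open>q \<in> B\<close> by blast
    qed
  qed
  moreover have "circle r t \<noteq> 0" for t using norm_circle[of r t] assms(2) by auto
  ultimately show ?thesis
    using c unfolding split_beta by (intro continuous_on_divide) auto
qed

text \<open>
  One radius that works for all circles centred near \<open>p\<close>, so that Cauchy's formula holds with a
  fixed domain of integration.
\<close>

lemma obtain_uniform_cball:
  fixes p :: "'v::metric_space"
  assumes "open S" "p \<in> S"
  obtains r where "0 < r" "\<And>q. q \<in> ball p r \<Longrightarrow> cball q r \<subseteq> S"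
proof -
  obtain e where e: "0 < e" "ball p e \<subseteq> S" using assms openE by blast
  have "cball q (e/2) \<subseteq> S" if "q \<in> ball p (e/2)" for q
  proof
    fix x assume "x \<in> cball q (e/2)"
    then have "dist p x < e" using that dist_triangle[of p x q] by simp
    then show "x \<in> S" using e by auto
  qed
  with e(1) show ?thesis using that[of "e/2"] by auto
qed

lemma hol_on_pd_continuous_on:
  fixes f :: "complex ^ 'n::finite \<Rightarrow> complex"
  assumes S: "open S" and f: "hol_on S f"
  shows "continuous_on S (pd i f)"
proof (intro continuous_at_imp_continuous_on ballI)
  fix p assume "p \<in> S"
  with S obtain r where r: "0 < r" "\<And>q. q \<in> ball p r \<Longrightarrow> cball q r \<subseteq> S"
    using obtain_uniform_cball by metis
  have "continuous_on (ball p r) (\<lambda>q. integral (cbox 0 1) (\<lambda>t. f (q + axis i (circle r t)) / circle r t))"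
    by (intro integral_continuous_on_param
        continuous_on_translated_circle[OF hol_on_continuous_on[OF f]] r)
  then have "continuous_on (ball p r) (pd i f)"
    by (rule continuous_on_eq) (metis pd_Cauchy[OF f r(1) r(2)])
  then show "isCont (pd i f) p"
    using r(1) by (simp add: continuous_on_eq_continuous_at)
qed

text \<open>
  Cauchy's formula is differentiated under the integral sign. Leibniz' rule requires the derivative
  of the integrand to be jointly continuous; this is continuity of the first partial derivatives,
  which holds by the same formula (lemma \<open>hol_on_pd_continuous_on\<close>). Complex linearity of the derivative is inherited from
  the integrand.
\<close>

lemma hol_on_pd:
  fixes f :: "complex ^ 'n::finite \<Rightarrow> complex"
  assumes S: "open S" and f: "hol_on S f"
  shows "hol_on S (pd i f)"
  unfolding hol_on_def
proof
  fix p assume "p \<in> S"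
  with S obtain r where r: "0 < r" "\<And>q. q \<in> ball p r \<Longrightarrow> cball q r \<subseteq> S"
    using obtain_uniform_cball by metis
  define D where "D q t h = (\<Sum>j\<in>UNIV. h $ j * (pd j f (q + axis i (circle r t)) / circle r t))" for q t h
  have bl: "bounded_linear (D q t)" for q t
    unfolding D_def
    by (intro bounded_linear_sum bounded_linear_compose[OF bounded_linear_mult_left bounded_linear_vec_nth])
  define fx where "fx q t = Blinfun (D q t)" for q t
  have fx: "blinfun_apply (fx q t) = D q t" for q t
    unfolding fx_def by (rule bounded_linear_Blinfun_apply[OF bl])
  let ?I = "integral (cbox 0 1) (fx p)"
  have cpd: "continuous_on (ball p r \<times> cbox 0 1)
      (\<lambda>x. pd j f (fst x + axis i (circle r (snd x))) / circle r (snd x))" for j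
    using continuous_on_translated_circle[OF hol_on_pd_continuous_on[OF S f, of j] r, where T = "cbox 0 1"]
    unfolding split_beta .
  have cfx: "continuous_on (ball p r \<times> cbox 0 1) (\<lambda>(q, t). fx q t)"
    unfolding split_beta
  proof (rule continuous_on_blinfun_componentwise)
    fix b :: "complex ^ 'n"
    show "continuous_on (ball p r \<times> cbox 0 1) (\<lambda>x. blinfun_apply (fx (fst x) (snd x)) b)"
      unfolding fx D_def by (intro continuous_on_sum continuous_on_mult continuous_on_const cpd)
  qed
  have "((\<lambda>q. integral (cbox 0 1) (\<lambda>t. f (q + axis i (circle r t)) / circle r t))
      has_derivative ?I) (at p within ball p r)"
  proof (rule leibniz_rule[OF _ _ cfx])
    fix q t assume q: "q \<in> ball p r" and "t \<in> cbox (0::real) 1"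
    have "q + axis i (circle r t) \<in> cball q r"
      using r(1) by (simp add: dist_norm norm_axis norm_circle)
    then have "q + axis i (circle r t) \<in> S" using r(2) q by blast
    note D = hol_on_has_derivative[OF f this]
    have "((\<lambda>q. q + axis i (circle r t)) has_derivative (\<lambda>h. h)) (at q)"
      by (auto intro!: derivative_eq_intros)
    from bounded_linear.has_derivative[OF bounded_linear_divide has_derivative_compose[OF this D]]
    have "((\<lambda>q. f (q + axis i (circle r t)) / circle r t) has_derivative D q t) (at q)"
      by (rule has_derivative_eq_rhs) (simp add: D_def fun_eq_iff sum_divide_distrib)
    then show "((\<lambda>q. f (q + axis i (circle r t)) / circle r t) has_derivative blinfun_apply (fx q t))
        (at q within ball p r)"
      unfolding fx by (rule has_derivative_at_withinI)
  next
    fix q assume q: "q \<in> ball p r"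
    have "continuous_on ({q} \<times> cbox 0 1) (\<lambda>(q, t). f (q + axis i (circle r t)) / circle r t)"
      using q by (intro continuous_on_translated_circle[OF hol_on_continuous_on[OF f] r(1)] r(2)) auto
    moreover have "continuous_on (cbox (0::real) 1) (Pair q)" by (intro continuous_intros)
    ultimately have "continuous_on (cbox 0 1) (\<lambda>t. f (q + axis i (circle r t)) / circle r t)"
      using continuous_on_compose2[of "{q} \<times> cbox 0 1"
          "\<lambda>(q, t). f (q + axis i (circle r t)) / circle r t" "cbox 0 1" "Pair q"] by auto
    then show "(\<lambda>t. f (q + axis i (circle r t)) / circle r t) integrable_on cbox 0 1"
      by (rule integrable_continuous)
  qed (use r in auto)
  then have "((\<lambda>q. integral (cbox 0 1) (\<lambda>t. f (q + axis i (circle r t)) / circle r t))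
      has_derivative ?I) (at p)"
    using r(1) by (simp add: at_within_open[of p "ball p r"])
  then have "(pd i f has_derivative ?I) (at p)"
    by (rule has_derivative_transform_within_open[of _ _ _ _ "ball p r"])
      (use r pd_Cauchy[OF f] in auto)
  moreover have "?I (c *s v) = c * ?I v" for c v
  proof -
    have "continuous_on (cbox (0::real) 1) (Pair p)" by (intro continuous_intros)
    moreover have "Pair p ` cbox (0::real) 1 \<subseteq> ball p r \<times> cbox 0 1" using r(1) by auto
    ultimately have "continuous_on (cbox 0 1) (fx p)"
      using continuous_on_compose2[OF cfx] by fastforce
    then have int: "fx p integrable_on cbox 0 1" by (rule integrable_continuous)
    have app: "?I w = integral (cbox 0 1) (\<lambda>t. D p t w)" for w
      using integral_linear[OF int blinfun.bounded_linear_left[of w]] by (simp add: o_def fx)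
    have "D p t (c *s v) = c * D p t v" for t
      by (simp add: D_def sum_distrib_left mult.assoc)
    then show ?thesis unfolding app by simp
  qed
  ultimately show "\<exists>D. (pd i f has_derivative D) (at p) \<and> (\<forall>c v. D (c *s v) = c * D v)" by blast
qed

lemma
  fixes f g :: "complex ^ 'n::finite \<Rightarrow> complex"
  assumes f: "hol_on S f"
  shows hol_on_add: "hol_on S g \<Longrightarrow> hol_on S (\<lambda>p. f p + g p)"
    and hol_on_mult: "hol_on S g \<Longrightarrow> hol_on S (\<lambda>p. f p * g p)"
    and hol_on_inverse: "(\<And>p. p \<in> S \<Longrightarrow> f p \<noteq> 0) \<Longrightarrow> hol_on S (\<lambda>p. inverse (f p))"
proof -
  assume g: "hol_on S g"
  show "hol_on S (\<lambda>p. f p + g p)"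
    unfolding hol_on_def
  proof
    fix p assume "p \<in> S"
    with f g obtain D E where "(f has_derivative D) (at p)" "\<And>c v. D (c *s v) = c * D v"
      "(g has_derivative E) (at p)" "\<And>c v. E (c *s v) = c * E v" unfolding hol_on_def by metis
    then show "\<exists>D. ((\<lambda>p. f p + g p) has_derivative D) (at p) \<and> (\<forall>c v. D (c *s v) = c * D v)"
      by (intro exI[of _ "\<lambda>h. D h + E h"]) (auto intro: has_derivative_add simp: algebra_simps)
  qed
  show "hol_on S (\<lambda>p. f p * g p)"
    unfolding hol_on_def
  proof
    fix p assume "p \<in> S"
    with f g obtain D E where "(f has_derivative D) (at p)" "\<And>c v. D (c *s v) = c * D v"
      "(g has_derivative E) (at p)" "\<And>c v. E (c *s v) = c * E v" unfolding hol_on_def by metis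
    then show "\<exists>D. ((\<lambda>p. f p * g p) has_derivative D) (at p) \<and> (\<forall>c v. D (c *s v) = c * D v)"
      by (intro exI[of _ "\<lambda>h. f p * E h + D h * g p"] conjI has_derivative_mult)
        (auto simp: algebra_simps)
  qed
next
  assume nz: "\<And>p. p \<in> S \<Longrightarrow> f p \<noteq> 0"
  show "hol_on S (\<lambda>p. inverse (f p))"
    unfolding hol_on_def
  proof
    fix p assume p: "p \<in> S"
    with f obtain D where D: "(f has_derivative D) (at p)" "\<And>c v. D (c *s v) = c * D v"
      unfolding hol_on_def by metis
    show "\<exists>D. ((\<lambda>p. inverse (f p)) has_derivative D) (at p) \<and> (\<forall>c v. D (c *s v) = c * D v)"
      using Deriv.has_derivative_inverse[OF nz[OF p] D(1)] D(2)
      by (intro exI[of _ "\<lambda>h. - (inverse (f p) * D h * inverse (f p))"]) auto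
  qed
qed

lemma hol_on_const: "hol_on S (\<lambda>p. c)"
  unfolding hol_on_def by (auto intro!: exI[of _ "\<lambda>h. 0"])

lemma hol_on_nth: "hol_on S (\<lambda>p. p $ k)"
  unfolding hol_on_def by (auto intro!: exI[of _ "\<lambda>h. h $ k"] has_derivative_nth)

lemma hol_on_compose_base:
  assumes "hol_on V f" shows "hol_on (base -` V) (\<lambda>p. f (base p))"
  unfolding hol_on_def
proof
  fix p assume "p \<in> base -` V"
  with assms obtain D where D: "(f has_derivative D) (at (base p))" "\<And>c v. D (c *s v) = c * D v"
    unfolding hol_on_def by auto
  have "base (c *s v) = c *s base v" for c and v :: "complex ^ 4"
    by (simp add: base_def vec_eq_iff forall_3)
  then show "\<exists>D. ((\<lambda>p. f (base p)) has_derivative D) (at p) \<and> (\<forall>c v. D (c *s v) = c * D v)"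
    using has_derivative_compose_base[OF D(1)] D(2) by (intro exI[of _ "\<lambda>h. D (base h)"]) auto
qed

lemma hol_on_cong:
  assumes "open S" "\<And>p. p \<in> S \<Longrightarrow> f p = g p" "hol_on S g"
  shows "hol_on S f"
  unfolding hol_on_def
proof
  fix p assume p: "p \<in> S"
  then obtain D where D: "(g has_derivative D) (at p)" "\<forall>c v. D (c *s v) = c * D v"
    using assms(3) unfolding hol_on_def by blast
  have "(f has_derivative D) (at p)"
    by (rule has_derivative_transform_within_open[OF D(1) assms(1) p]) (simp add: assms(2))
  with D(2) show "\<exists>D. (f has_derivative D) (at p) \<and> (\<forall>c v. D (c *s v) = c * D v)" by blast
qed

section \<open>The null coframe and the quaternion units\<close>

lemma vector_4:
  "(vector [x, y, z, w] :: 'b::zero ^ 4) $ 1 = x"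
  "(vector [x, y, z, w] :: 'b ^ 4) $ 2 = y"
  "(vector [x, y, z, w] :: 'b ^ 4) $ 3 = z"
  "(vector [x, y, z, w] :: 'b ^ 4) $ 4 = w"
  unfolding vector_def by simp_all

text \<open>
  Row \<open>i\<close> holds the components of \<open>e\<^sub>i\<close> with respect to \<open>dx, dy, dt, dz\<close>. The parameters \<open>f\<close>, \<open>a\<close>, \<open>b\<close>
  stand for \<open>u\<close>, \<open>u\<^sub>x\<close>, \<open>u\<^sub>y\<close>; the values are kept as parameters so that the same matrices serve real
  and complex solutions. Division is written with \<open>inverse\<close> to match the closure properties of
  regular functions.
\<close>

definition coframe :: "'b::field \<Rightarrow> 'b \<Rightarrow> 'b \<Rightarrow> 'b \<Rightarrow> 'b ^ 4 ^ 4" where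
  "coframe f a b z = vector
     [vector [0, 0, - b, 1],
      vector [0, 1, b * inverse a + z, - inverse a],
      vector [0, 0, 1, 0],
      vector [a, 0, a * f - z * b, z]]"

definition frame :: "'b::field \<Rightarrow> 'b \<Rightarrow> 'b \<Rightarrow> 'b \<Rightarrow> 'b ^ 4 ^ 4" where
  "frame f a b z = vector
     [vector [- z * inverse a, 0, - f, inverse a],
      vector [inverse a, 1, - z, 0],
      vector [0, 0, 1, 0],
      vector [1, 0, b, 0]]"

text \<open>The Gram matrix of \<open>2 (e\<^sub>1 e\<^sub>2 - e\<^sub>3 e\<^sub>4)\<close>.\<close>

definition null_form :: "'b::field ^ 4 ^ 4" where
  "null_form = vector
     [vector [0, 1, 0, 0], vector [1, 0, 0, 0], vector [0, 0, 0, - 1], vector [0, 0, - 1, 0]]"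

text \<open>
  With \<open>B\<^sub>k\<close> the product of \<open>null_form\<close>, which is its own inverse, and the matrix of \<open>\<Sigma>\<^sub>k\<close>, these are
  \<open>B\<^sub>2 - B\<^sub>1\<close>, \<open>\<i> (B\<^sub>1 + B\<^sub>2)\<close> and \<open>- \<i> B\<^sub>3\<close>. The real combination \<open>B\<^sub>1 + B\<^sub>2\<close> and \<open>B\<^sub>3\<close> square to \<open>+1\<close>, which
  is why two of the units have to be imaginary.
\<close>

definition QI :: "complex ^ 4 ^ 4" where
  "QI = vector
     [vector [0, 0, 0, 1], vector [0, 0, - 1, 0], vector [0, 1, 0, 0], vector [- 1, 0, 0, 0]]"

definition QJ :: "complex ^ 4 ^ 4" where
  "QJ = vector
     [vector [0, 0, 0, \<i>], vector [0, 0, \<i>, 0], vector [0, \<i>, 0, 0], vector [\<i>, 0, 0, 0]]"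

definition QK :: "complex ^ 4 ^ 4" where
  "QK = vector
     [vector [\<i>, 0, 0, 0], vector [0, - \<i>, 0, 0], vector [0, 0, \<i>, 0], vector [0, 0, 0, - \<i>]]"

definition skew :: "'b::ab_group_add \<Rightarrow> 'b \<Rightarrow> 'b \<Rightarrow> 'b \<Rightarrow> 'b \<Rightarrow> 'b \<Rightarrow> 'b ^ 4 ^ 4" where
  "skew c12 c13 c14 c23 c24 c34 = vector
     [vector [0, c12, c13, c14],
      vector [- c12, 0, c23, c24],
      vector [- c13, - c23, 0, c34],
      vector [- c14, - c24, - c34, 0]]"

lemmas matrix_4 = vec_eq_iff forall_4 matrix_matrix_mult_def sum_4 vector_4 transpose_def

lemma coframe_frame: "a \<noteq> 0 \<Longrightarrow> coframe f a b z ** frame f a b z = mat 1"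
  by (simp add: matrix_4 mat_def coframe_def frame_def field_simps)

lemma coframe_null_form:
  assumes "a \<noteq> 0"
  shows "transpose (coframe f a b z) ** null_form ** coframe f a b z = vector
    [vector [0, 0, - a, 0],
     vector [0, 0, - b, 1],
     vector [- a, - b, - 2 * b * b / a - 2 * a * f, 2 * b / a],
     vector [0, 1, 2 * b / a, - 2 / a]]"
  unfolding vec_eq_iff forall_4
  using assms
  by (intro conjI; simp add: matrix_matrix_mult_def transpose_def sum_4 vector_4 coframe_def null_form_def;
      simp add: field_simps)

lemma quaternionic_Q: "quaternionic QI QJ QK"
  by (simp add: quaternionic_def matrix_4 mat_def QI_def QJ_def QK_def)

lemma orthogonal_Q: "A \<in> {QI, QJ, QK} \<Longrightarrow> orthogonal_endo null_form A"
  unfolding orthogonal_endo_def vec_eq_iff forall_4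
  by (elim insertE emptyE; intro conjI;
      simp add: matrix_matrix_mult_def transpose_def sum_4 vector_4 null_form_def QI_def QJ_def QK_def)

lemma quaternionic_conj:
  fixes E F :: "complex ^ 4 ^ 4"
  assumes EF: "E ** F = mat 1" and Q: "quaternionic I J K"
  shows "quaternionic (F ** I ** E) (F ** J ** E) (F ** K ** E)"
proof -
  have FE: "F ** E = mat 1" using EF matrix_left_right_inverse by blast
  have m: "(F ** A ** E) ** (F ** B ** E) = F ** (A ** B) ** E" for A B
  proof -
    have "(F ** A ** E) ** (F ** B ** E) = F ** A ** (E ** F) ** B ** E"
      by (simp only: matrix_mul_assoc)
    then show ?thesis by (simp add: EF matrix_mul_assoc)
  qed
  have n: "F ** (- A) ** E = - (F ** A ** E)" for A :: "complex ^ 4 ^ 4"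
    by (simp add: vec_eq_iff matrix_matrix_mult_def sum_negf)
  have "F ** (- mat 1) ** E = - mat 1" by (simp add: n FE)
  then show ?thesis using Q unfolding quaternionic_def m by (metis n)
qed

lemma orthogonal_conj:
  fixes E F :: "complex ^ 4 ^ 4"
  assumes EF: "E ** F = mat 1" and A: "orthogonal_endo G A"
  shows "orthogonal_endo (transpose E ** G ** E) (F ** A ** E)"
proof -
  have FE: "transpose F ** transpose E = mat 1"
    by (metis EF matrix_transpose_mul transpose_mat)
  have "transpose (F ** A ** E) ** (transpose E ** G ** E) ** (F ** A ** E)
    = transpose E ** (transpose A ** ((transpose F ** transpose E) ** G ** (E ** F)) ** A) ** E"
    by (simp add: matrix_transpose_mul matrix_mul_assoc)
  also have "\<dots> = transpose E ** G ** E"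
    using A by (simp add: EF FE orthogonal_endo_def)
  finally show ?thesis by (simp add: orthogonal_endo_def)
qed

text \<open>
  The two-forms in coordinates. The inverse of \<open>a\<close>, present in both the frame and the coframe,
  cancels, so that only polynomials in \<open>u\<close>, \<open>u\<^sub>x\<close>, \<open>u\<^sub>y\<close> and \<open>z\<close> have to be differentiated.
\<close>

lemma
  fixes f a b z :: complex
  assumes a: "a \<noteq> 0"
  defines "E \<equiv> coframe f a b z" and "F \<equiv> frame f a b z"
  shows form_I: "(transpose E ** null_form ** E) ** (F ** QI ** E) =
      skew (- a) (- b - z * a) 1 (f * a - z * b) z (f + z * z + 1)"
    and form_J: "(transpose E ** null_form ** E) ** (F ** QJ ** E) =
      skew (\<i> * (- a)) (\<i> * (- b - z * a)) \<i> (\<i> * (f * a - z * b)) (\<i> * z) (\<i> * (f + z * z - 1))"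
    and form_K: "(transpose E ** null_form ** E) ** (F ** QK ** E) =
      skew 0 (- \<i> * a) 0 (- \<i> * b) \<i> (2 * \<i> * z)"
proof -
  have *: "(transpose E ** null_form ** E) ** (F ** A ** E) = transpose E ** (null_form ** A) ** E" for A
  proof -
    have "(transpose E ** null_form ** E) ** (F ** A ** E) =
        transpose E ** null_form ** (E ** F) ** A ** E"
      by (simp only: matrix_mul_assoc)
    then show ?thesis by (simp add: E_def F_def coframe_frame[OF a] matrix_mul_assoc)
  qed
  show "(transpose E ** null_form ** E) ** (F ** QI ** E) =
      skew (- a) (- b - z * a) 1 (f * a - z * b) z (f + z * z + 1)"
    unfolding * using a
    by (simp add: matrix_4 null_form_def QI_def skew_def E_def coframe_def field_simps)
  show "(transpose E ** null_form ** E) ** (F ** QJ ** E) =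
      skew (\<i> * (- a)) (\<i> * (- b - z * a)) \<i> (\<i> * (f * a - z * b)) (\<i> * z) (\<i> * (f + z * z - 1))"
    unfolding * using a
    by (simp add: matrix_4 null_form_def QJ_def skew_def E_def coframe_def field_simps)
  show "(transpose E ** null_form ** E) ** (F ** QK ** E) =
      skew 0 (- \<i> * a) 0 (- \<i> * b) \<i> (2 * \<i> * z)"
    unfolding * using a
    by (simp add: matrix_4 null_form_def QK_def skew_def E_def coframe_def field_simps)
qed

lemma dKP_metric_eq:
  assumes "pd 1 u (base p) \<noteq> 0"
  shows "dKP_metric u p =
    (let E = coframe (u (base p)) (pd 1 u (base p)) (pd 2 u (base p)) (p $ 4)
     in transpose E ** null_form ** E)"
  using assms unfolding Let_def coframe_null_form[OF assms] vec_eq_iff forall_4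
  by (intro conjI; simp add: vector_4 dKP_metric_def Let_def sprod_def axis_def;
      simp add: field_simps)

lemma transpose_coframe_null_form:
  assumes "a \<noteq> 0"
  shows "transpose (transpose (coframe f a b z) ** null_form ** coframe f a b z) =
    transpose (coframe f a b z) ** null_form ** coframe f a b z"
  unfolding coframe_null_form[OF assms] by (simp add: vec_eq_iff forall_4 transpose_def vector_4)

text \<open>
  The columns are the orthogonal vectors \<open>E\<^sub>1 + E\<^sub>2 / 2\<close>, \<open>E\<^sub>3 - E\<^sub>4 / 2\<close> of square \<open>+1\<close> and \<open>E\<^sub>1 - E\<^sub>2 / 2\<close>,
  \<open>E\<^sub>3 + E\<^sub>4 / 2\<close> of square \<open>-1\<close>, where \<open>E\<^sub>i\<close> is the frame dual to \<open>e\<^sub>i\<close>.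
\<close>

definition orthonormal :: "real ^ 4 ^ 4" where
  "orthonormal = vector
     [vector [1, 0, 1, 0], vector [1/2, 0, - 1/2, 0], vector [0, 1, 0, 1], vector [0, - 1/2, 0, 1/2]]"

lemma neutral_signature_coframe:
  fixes E F :: "real ^ 4 ^ 4"
  assumes EF: "E ** F = mat 1"
  shows "neutral_signature (transpose E ** null_form ** E)"
proof -
  let ?Q = orthonormal
  let ?Q' = "vector
     [vector [1/2, 1, 0, 0], vector [0, 0, 1/2, - 1], vector [1/2, - 1, 0, 0], vector [0, 0, 1/2, 1]]
     :: real ^ 4 ^ 4"
  have "?Q ** ?Q' = mat 1"
    by (simp add: matrix_4 mat_def orthonormal_def)
  then have "invertible ?Q" using invertible_right_inverse by blast
  moreover have "invertible F" using EF invertible_left_inverse by blast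
  ultimately have "invertible (F ** ?Q)" by (simp add: invertible_mult)
  moreover have "transpose (F ** ?Q) ** (transpose E ** null_form ** E) ** (F ** ?Q) =
    (\<chi> i j. if i = j then (if i = 1 \<or> i = 2 then 1 else - 1) else 0)"
  proof -
    have FE: "transpose F ** transpose E = mat 1"
      by (metis EF matrix_transpose_mul transpose_mat)
    have "transpose (F ** ?Q) ** (transpose E ** null_form ** E) ** (F ** ?Q) =
      transpose ?Q ** (transpose F ** transpose E) ** null_form ** (E ** F) ** ?Q"
      by (simp add: matrix_transpose_mul matrix_mul_assoc)
    also have "\<dots> = transpose ?Q ** null_form ** ?Q" by (simp add: EF FE)
    also have "\<dots> = (\<chi> i j. if i = j then (if i = 1 \<or> i = 2 then 1 else - 1) else 0)"
      by (simp add: matrix_4 orthonormal_def null_form_def)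
    finally show ?thesis .
  qed
  ultimately show ?thesis unfolding neutral_signature_def by blast
qed

lemma invertible_coframe:
  fixes E F :: "complex ^ 4 ^ 4"
  assumes EF: "E ** F = mat 1"
  shows "invertible (transpose E ** null_form ** E)"
proof -
  have FE: "transpose F ** transpose E = mat 1"
    by (metis EF matrix_transpose_mul transpose_mat)
  have "null_form ** null_form = (mat 1 :: complex ^ 4 ^ 4)"
    by (simp add: matrix_4 mat_def null_form_def)
  then have "invertible (null_form :: complex ^ 4 ^ 4)"
    using invertible_left_inverse by blast
  moreover have "invertible E" "invertible (transpose E)"
    using EF FE invertible_left_inverse invertible_right_inverse by blast+
  ultimately show ?thesis by (simp add: invertible_mult)
qed

section \<open>Regularity of the components\<close>

text \<open>
  The regularity class \<open>R\<close> is either smoothness or holomorphy; only its closure under the field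
  operations matters for matrices that are rational in \<open>u\<close>, \<open>u\<^sub>x\<close>, \<open>u\<^sub>y\<close> and \<open>z\<close>.
\<close>

lemma matrix_mult_entries_closed:
  fixes A B :: "'p \<Rightarrow> 'b::field ^ 4 ^ 4"
  assumes R: "\<And>f g. R f \<Longrightarrow> R g \<Longrightarrow> R (\<lambda>p. f p + g p)" "\<And>f g. R f \<Longrightarrow> R g \<Longrightarrow> R (\<lambda>p. f p * g p)"
    and A: "\<And>i j. R (\<lambda>p. A p $ i $ j)" and B: "\<And>i j. R (\<lambda>p. B p $ i $ j)"
  shows "R (\<lambda>p. (A p ** B p) $ i $ j)"
  by (simp add: matrix_matrix_mult_def sum_4 R A B)

lemma frame_entries_closed:
  assumes "\<And>c. R (\<lambda>p. c)" "\<And>f g. R f \<Longrightarrow> R g \<Longrightarrow> R (\<lambda>p. f p + g p)"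
    "\<And>f g. R f \<Longrightarrow> R g \<Longrightarrow> R (\<lambda>p. f p * g p)"
    and "R f" "R a" "R b" "R z" "R (\<lambda>p. inverse (a p))"
  shows "R (\<lambda>p. coframe (f p) (a p) (b p) (z p) $ i $ j)"
    "R (\<lambda>p. frame (f p) (a p) (b p) (z p) $ i $ j)"
proof -
  have m: "R (\<lambda>p. - g p)" if "R g" for g using assms(3)[OF assms(1)[of "-1"] that] by simp
  have d: "R (\<lambda>p. g p - h p)" if "R g" "R h" for g h using assms(2)[OF that(1) m[OF that(2)]] by simp
  show "R (\<lambda>p. coframe (f p) (a p) (b p) (z p) $ i $ j)"
    using exhaust_4[of i] exhaust_4[of j]
    by (elim disjE) (simp_all add: coframe_def vector_4 assms m d)
  show "R (\<lambda>p. frame (f p) (a p) (b p) (z p) $ i $ j)"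
    using exhaust_4[of i] exhaust_4[of j]
    by (elim disjE) (simp_all add: frame_def vector_4 assms m d)
qed

lemma metric_entries_closed:
  assumes R: "\<And>c. R (\<lambda>p. c)" "\<And>f g. R f \<Longrightarrow> R g \<Longrightarrow> R (\<lambda>p. f p + g p)"
    "\<And>f g. R f \<Longrightarrow> R g \<Longrightarrow> R (\<lambda>p. f p * g p)"
    and f: "R f" "R a" "R b" "R z" "R (\<lambda>p. inverse (a p))"
  defines "E \<equiv> \<lambda>p. coframe (f p) (a p) (b p) (z p)"
  shows "R (\<lambda>p. (transpose (E p) ** null_form ** E p) $ i $ j)"
proof -
  have RE: "R (\<lambda>p. E p $ i $ j)" for i j
    unfolding E_def using frame_entries_closed(1)[of R f a b z i j] R f by blast
  have RT: "R (\<lambda>p. transpose (E p) $ i $ j)" for i j using RE[of j i] by (simp add: transpose_def)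
  have RN: "R (\<lambda>p. (transpose (E p) ** null_form) $ i $ j)" for i j
    by (rule matrix_mult_entries_closed[of R "\<lambda>p. transpose (E p)" "\<lambda>p. null_form", OF R(2,3) RT R(1)])
  show ?thesis
    by (rule matrix_mult_entries_closed[of R "\<lambda>p. transpose (E p) ** null_form" E, OF R(2,3) RN RE])
qed

section \<open>Closed two-forms\<close>

text \<open>
  The derivatives at \<open>p\<close> see a neighbourhood of \<open>p\<close>, so openness of \<open>M\<close> is what allows the
  coordinate expressions, valid only where \<open>u\<^sub>x \<noteq> 0\<close>, to be substituted.
\<close>

lemma closed_form_cong:
  assumes "open M" "\<And>p. p \<in> M \<Longrightarrow> w p = w' p" "closed_form M w'"
  shows "closed_form M w"
proof -
  have "pd i (\<lambda>q. w q $ j $ k) p = pd i (\<lambda>q. w' q $ j $ k) p" if "p \<in> M" for i j k p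
    using that assms(2) by (intro pd_cong[OF assms(1)]) auto
  then show ?thesis using assms(3) by (simp add: closed_form_def)
qed

text \<open>
  For a skew matrix the cyclic sums with a repeated index vanish and the others agree up to sign,
  which leaves one equation for each of the four coordinate three-forms.
\<close>

lemma closed_skew:
  fixes c12 c13 c14 c23 c24 c34 :: "'a::real_normed_field ^ 4 \<Rightarrow> complex"
  assumes d: "\<And>p. p \<in> M \<Longrightarrow> c12 differentiable at p" "\<And>p. p \<in> M \<Longrightarrow> c13 differentiable at p"
      "\<And>p. p \<in> M \<Longrightarrow> c14 differentiable at p" "\<And>p. p \<in> M \<Longrightarrow> c23 differentiable at p"
      "\<And>p. p \<in> M \<Longrightarrow> c24 differentiable at p" "\<And>p. p \<in> M \<Longrightarrow> c34 differentiable at p"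
    and "\<And>p. p \<in> M \<Longrightarrow> pd 1 c23 p - pd 2 c13 p + pd 3 c12 p = 0"
      "\<And>p. p \<in> M \<Longrightarrow> pd 1 c24 p - pd 2 c14 p + pd 4 c12 p = 0"
      "\<And>p. p \<in> M \<Longrightarrow> pd 1 c34 p - pd 3 c14 p + pd 4 c13 p = 0"
      "\<And>p. p \<in> M \<Longrightarrow> pd 2 c34 p - pd 3 c24 p + pd 4 c23 p = 0"
  shows "closed_form M (\<lambda>p. skew (c12 p) (c13 p) (c14 p) (c23 p) (c24 p) (c34 p))"
  unfolding closed_form_def forall_4 skew_def vector_4
  using assms by (simp add: pd_const pd_minus algebra_simps)

lemma pd_dKP:
  fixes u :: "'a::{real_normed_field,euclidean_space} ^ 3 \<Rightarrow> 'a"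
  assumes U: "open U" "p \<in> U" and u: "\<And>p. p \<in> U \<Longrightarrow> u differentiable at p"
    "\<And>i p. p \<in> U \<Longrightarrow> pd i u differentiable at p"
    and dKP: "dKP_solution U u"
  shows "pd 3 (pd 1 u) p = pd 1 u p * pd 1 u p + u p * pd 1 (pd 1 u) p + pd 2 (pd 2 u) p"
proof -
  have "pd 1 (\<lambda>q. pd 3 u q - u q * pd 1 u q) p = pd 2 (pd 2 u) p"
    using dKP U by (simp add: dKP_solution_def)
  moreover have "pd 1 (\<lambda>q. pd 3 u q - u q * pd 1 u q) p =
      pd 1 (pd 3 u) p - (u p * pd 1 (pd 1 u) p + pd 1 u p * pd 1 u p)"
    using u U by (simp add: pd_diff pd_mult differentiable_mult)
  moreover have "pd 1 (pd 3 u) p = pd 3 (pd 1 u) p"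
    using u U by (intro pd_commute[OF U]) auto
  ultimately show ?thesis by (simp add: algebra_simps)
qed

text \<open>
  The part of the argument that is common to real and holomorphic solutions. The scalars \<open>f\<close>, \<open>a\<close>,
  \<open>b\<close> are \<open>u\<close>, \<open>u\<^sub>x\<close>, \<open>u\<^sub>y\<close> as complex-valued functions on 4-space. The differential equations between
  them are those used by the closedness of the forms: the dKP equation gives the
  \<open>dx \<and> dy \<and> dt\<close> component for \<open>I\<close> and \<open>J\<close>, symmetry of the mixed derivative \<open>u\<^sub>x\<^sub>y\<close> enters for all three,
  and the remaining components use that \<open>f\<close>, \<open>a\<close>, \<open>b\<close> do not depend on \<open>z\<close>.
\<close>

lemma hyperkaehler_tripleI:
  fixes f a b z :: "'a::real_normed_field ^ 4 \<Rightarrow> complex"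
  assumes M: "open M"
    and R: "\<And>c. R (\<lambda>p. c)" "\<And>f g. R f \<Longrightarrow> R g \<Longrightarrow> R (\<lambda>p. f p + g p)"
      "\<And>f g. R f \<Longrightarrow> R g \<Longrightarrow> R (\<lambda>p. f p * g p)"
      "R f" "R a" "R b" "R z" "R (\<lambda>p. inverse (a p))"
    and nz: "\<And>p. p \<in> M \<Longrightarrow> a p \<noteq> 0"
    and diff: "\<And>p. p \<in> M \<Longrightarrow> f differentiable at p" "\<And>p. p \<in> M \<Longrightarrow> a differentiable at p"
      "\<And>p. p \<in> M \<Longrightarrow> b differentiable at p" "\<And>p. p \<in> M \<Longrightarrow> z differentiable at p"
    and z: "\<And>i p. p \<in> M \<Longrightarrow> pd i z p = (if i = 4 then 1 else 0)"
    and f: "\<And>p. p \<in> M \<Longrightarrow> pd 1 f p = a p" "\<And>p. p \<in> M \<Longrightarrow> pd 2 f p = b p"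
    and inv: "\<And>p. p \<in> M \<Longrightarrow> pd 4 f p = 0" "\<And>p. p \<in> M \<Longrightarrow> pd 4 a p = 0" "\<And>p. p \<in> M \<Longrightarrow> pd 4 b p = 0"
    and ab: "\<And>p. p \<in> M \<Longrightarrow> pd 1 b p = pd 2 a p"
    and dKP: "\<And>p. p \<in> M \<Longrightarrow> pd 3 a p = a p * a p + f p * pd 1 a p + pd 2 b p"
  defines "E \<equiv> \<lambda>p. coframe (f p) (a p) (b p) (z p)" and "F \<equiv> \<lambda>p. frame (f p) (a p) (b p) (z p)"
  assumes G: "\<And>p. p \<in> M \<Longrightarrow> G p = transpose (E p) ** null_form ** E p"
  shows "hyperkaehler_triple R M G
    (\<lambda>p. F p ** QI ** E p) (\<lambda>p. F p ** QJ ** E p) (\<lambda>p. F p ** QK ** E p)"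
proof -
  have EF: "E p ** F p = mat 1" if "p \<in> M" for p
    unfolding E_def F_def by (rule coframe_frame[OF nz[OF that]])
  have RE: "R (\<lambda>p. E p $ i $ j)" and RF: "R (\<lambda>p. F p $ i $ j)" for i j
    unfolding E_def F_def
    using frame_entries_closed[of R f a b z i j] R by blast+
  have RA: "R (\<lambda>p. (F p ** A) $ i $ j)" for A :: "complex ^ 4 ^ 4" and i j
    by (rule matrix_mult_entries_closed[of R F "\<lambda>p. A", OF R(2,3) RF R(1)])
  have reg: "R (\<lambda>p. (F p ** A ** E p) $ i $ j)" for A i j
    by (rule matrix_mult_entries_closed[of R "\<lambda>p. F p ** A" E, OF R(2,3) RA RE])
  have orth: "orthogonal_endo (G p) (F p ** A ** E p)" if "p \<in> M" "A \<in> {QI, QJ, QK}" for p A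
    unfolding G[OF that(1)] by (rule orthogonal_conj[OF EF[OF that(1)] orthogonal_Q[OF that(2)]])
  note pd_rules = pd_const pd_add pd_diff pd_minus pd_mult z f inv ab dKP
  have cI: "closed_form M (\<lambda>p. G p ** (F p ** QI ** E p))"
  proof (rule closed_form_cong[OF M])
    show "G p ** (F p ** QI ** E p) = skew (- a p) (- b p - z p * a p) 1
        (f p * a p - z p * b p) (z p) (f p + z p * z p + 1)" if "p \<in> M" for p
      unfolding G[OF that] E_def F_def by (rule form_I[OF nz[OF that]])
    show "closed_form M (\<lambda>p. skew (- a p) (- b p - z p * a p) 1
        (f p * a p - z p * b p) (z p) (f p + z p * z p + 1))"
      by (rule closed_skew) (simp_all add: diff pd_rules)
  qed
  have cJ: "closed_form M (\<lambda>p. G p ** (F p ** QJ ** E p))"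
  proof (rule closed_form_cong[OF M])
    show "G p ** (F p ** QJ ** E p) = skew (\<i> * (- a p)) (\<i> * (- b p - z p * a p)) \<i>
        (\<i> * (f p * a p - z p * b p)) (\<i> * z p) (\<i> * (f p + z p * z p - 1))" if "p \<in> M" for p
      unfolding G[OF that] E_def F_def by (rule form_J[OF nz[OF that]])
    show "closed_form M (\<lambda>p. skew (\<i> * (- a p)) (\<i> * (- b p - z p * a p)) \<i>
        (\<i> * (f p * a p - z p * b p)) (\<i> * z p) (\<i> * (f p + z p * z p - 1)))"
      by (rule closed_skew) (simp_all add: diff pd_rules algebra_simps)
  qed
  have cK: "closed_form M (\<lambda>p. G p ** (F p ** QK ** E p))"
  proof (rule closed_form_cong[OF M])
    show "G p ** (F p ** QK ** E p) = skew 0 (- \<i> * a p) 0 (- \<i> * b p) \<i> (2 * \<i> * z p)"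
      if "p \<in> M" for p
      unfolding G[OF that] E_def F_def by (rule form_K[OF nz[OF that]])
    show "closed_form M (\<lambda>p. skew 0 (- \<i> * a p) 0 (- \<i> * b p) \<i> (2 * \<i> * z p))"
      by (rule closed_skew) (simp_all add: diff pd_rules)
  qed
  show ?thesis
    unfolding hyperkaehler_triple_def
    using quaternionic_conj[OF EF quaternionic_Q] reg orth cI cJ cK by blast
qed

section \<open>Real and holomorphic solutions\<close>

lemma of_real_frame:
  "coframe (complex_of_real f) (of_real a) (of_real b) (of_real z) = map_matrix of_real (coframe f a b z)"
  "frame (complex_of_real f) (of_real a) (of_real b) (of_real z) = map_matrix of_real (frame f a b z)"
  by (simp_all add: vec_eq_iff forall_4 vector_4 coframe_def frame_def)

lemma of_real_coframe_null_form:
  fixes f a b z :: real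
  defines "E \<equiv> coframe f a b z"
  shows "map_matrix complex_of_real (transpose E ** null_form ** E) =
    transpose (map_matrix of_real E) ** null_form ** map_matrix of_real E"
proof -
  have "(null_form :: complex ^ 4 ^ 4) = map_matrix of_real null_form"
    by (simp add: vec_eq_iff forall_4 vector_4 null_form_def)
  then show ?thesis
    by (simp add: vec_eq_iff matrix_matrix_mult_def transpose_def)
qed

text \<open>
  The frame of a real solution is real, so conjugation by it preserves the reality type of the
  constant units.
\<close>

lemma conj_real_imag:
  fixes F E :: "real ^ 4 ^ 4"
  defines "c \<equiv> map_matrix complex_of_real"
  shows "(c F ** QI ** c E) $ i $ j \<in> \<real>" "Re ((c F ** QJ ** c E) $ i $ j) = 0"
    "Re ((c F ** QK ** c E) $ i $ j) = 0"
  by (simp_all add: c_def matrix_matrix_mult_def sum_4 vector_4 QI_def QJ_def QK_def)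

theorem hyperkaehler_real_dKP:
  assumes U: "open U" and u: "smooth_on U u" and dKP: "dKP_solution U u"
    and nz: "\<forall>p\<in>U. pd 1 u p \<noteq> 0"
  shows "hyperkaehler_real (base -` U) (dKP_metric u)"
proof -
  define M where "M = base -` U"
  define f a b z where "f p = u (base p)" and "a p = pd 1 u (base p)" and "b p = pd 2 u (base p)"
    and "z p = p $ 4" for p :: "real ^ 4"
  define E F where "E p = coframe (f p) (a p) (b p) (z p)" and "F p = frame (f p) (a p) (b p) (z p)" for p
  have M: "open M" unfolding M_def by (rule open_vimage_base[OF U])
  have a: "a p \<noteq> 0" if "p \<in> M" for p using nz that by (simp add: a_def M_def)
  have g: "dKP_metric u p = transpose (E p) ** null_form ** E p" if "p \<in> M" for p
    using dKP_metric_eq[of u p] a[OF that] by (simp add: a_def E_def f_def b_def z_def Let_def)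
  have s: "smooth_on M f" "smooth_on M a" "smooth_on M b" "smooth_on M z"
    unfolding f_def[abs_def] a_def[abs_def] b_def[abs_def] z_def[abs_def] M_def
    using smooth_on_compose_base[OF U] u smooth_on_pd[OF u] smooth_on_nth[OF open_vimage_base[OF U]]
    by blast+
  have si: "smooth_on M (\<lambda>p. inverse (a p))"
    by (rule smooth_on_inverse[OF M s(2) a])
  have sg: "smooth_on M (\<lambda>p. dKP_metric u p $ i $ j)" for i j
  proof (rule smooth_on_cong[OF M])
    show "dKP_metric u p $ i $ j = (transpose (E p) ** null_form ** E p) $ i $ j" if "p \<in> M" for p
      by (simp add: g[OF that])
    show "smooth_on M (\<lambda>p. (transpose (E p) ** null_form ** E p) $ i $ j)"
      unfolding E_def
      by (rule metric_entries_closed[of "smooth_on M"])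
        (simp_all add: smooth_on_const smooth_on_add smooth_on_mult s si M)
  qed
  let ?c = complex_of_real
  have sc: "smooth_on M (\<lambda>p. ?c (h p))" if "smooth_on M h" for h
    by (rule smooth_on_bounded_linear[OF M bounded_linear_of_real that])
  have pdc: "pd i (\<lambda>p. ?c (h p)) p = ?c (pd i h p)" if "smooth_on M h" "p \<in> M" for h i p
    by (rule pd_bounded_linear[OF bounded_linear_of_real smooth_on_differentiable[OF that]])
  have d: "u differentiable at (base p)" "pd i u differentiable at (base p)" if "p \<in> M" for p i
    using that smooth_on_differentiable[OF u] smooth_on_differentiable[OF smooth_on_pd[OF u]]
    by (auto simp: M_def)
  note pd_base = pd_compose_base[OF d(1)] pd_compose_base[OF d(2)]
  have "hyperkaehler_triple (smooth_on M) M (\<lambda>p. map_matrix ?c (dKP_metric u p))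
    (\<lambda>p. frame (?c (f p)) (?c (a p)) (?c (b p)) (?c (z p)) ** QI ** coframe (?c (f p)) (?c (a p)) (?c (b p)) (?c (z p)))
    (\<lambda>p. frame (?c (f p)) (?c (a p)) (?c (b p)) (?c (z p)) ** QJ ** coframe (?c (f p)) (?c (a p)) (?c (b p)) (?c (z p)))
    (\<lambda>p. frame (?c (f p)) (?c (a p)) (?c (b p)) (?c (z p)) ** QK ** coframe (?c (f p)) (?c (a p)) (?c (b p)) (?c (z p)))"
  proof (rule hyperkaehler_tripleI[OF M])
    show "smooth_on M (\<lambda>p. inverse (?c (a p)))" using sc[OF si] by simp
  next
    fix p assume p: "p \<in> M"
    then have pU: "base p \<in> U" by (simp add: M_def)
    show "?c (a p) \<noteq> 0" using a[OF p] by simp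
    show "pd i (\<lambda>p. ?c (z p)) p = (if i = 4 then 1 else 0)" for i
      unfolding pdc[OF s(4) p] by (simp add: z_def[abs_def] pd_nth)
    show "pd 1 (\<lambda>p. ?c (f p)) p = ?c (a p)" "pd 2 (\<lambda>p. ?c (f p)) p = ?c (b p)" "pd 4 (\<lambda>p. ?c (f p)) p = 0"
      unfolding pdc[OF s(1) p] by (simp_all add: f_def[abs_def] a_def b_def pd_base p)
    show "pd 4 (\<lambda>p. ?c (a p)) p = 0" "pd 4 (\<lambda>p. ?c (b p)) p = 0"
      unfolding pdc[OF s(2) p] pdc[OF s(3) p] by (simp_all add: a_def[abs_def] b_def[abs_def] pd_base p)
    have "pd 1 (pd 2 u) (base p) = pd 2 (pd 1 u) (base p)"
      using smooth_on_differentiable[OF u] smooth_on_differentiable[OF smooth_on_pd[OF u]] pU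
      by (intro pd_commute[OF U pU]) auto
    then show "pd 1 (\<lambda>p. ?c (b p)) p = pd 2 (\<lambda>p. ?c (a p)) p"
      unfolding pdc[OF s(2) p] pdc[OF s(3) p] by (simp add: a_def[abs_def] b_def[abs_def] pd_base p)
    have "pd 3 (pd 1 u) (base p) = pd 1 u (base p) * pd 1 u (base p) +
        u (base p) * pd 1 (pd 1 u) (base p) + pd 2 (pd 2 u) (base p)"
      using smooth_on_differentiable[OF u] smooth_on_differentiable[OF smooth_on_pd[OF u]]
      by (intro pd_dKP[OF U pU _ _ dKP]) auto
    then show "pd 3 (\<lambda>p. ?c (a p)) p = ?c (a p) * ?c (a p) + ?c (f p) * pd 1 (\<lambda>p. ?c (a p)) p
        + pd 2 (\<lambda>p. ?c (b p)) p"
      unfolding pdc[OF s(2) p] pdc[OF s(3) p]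
      by (simp add: a_def[abs_def] b_def[abs_def] f_def pd_base p)
    show "map_matrix ?c (dKP_metric u p) =
      transpose (coframe (?c (f p)) (?c (a p)) (?c (b p)) (?c (z p))) ** null_form **
        coframe (?c (f p)) (?c (a p)) (?c (b p)) (?c (z p))"
      unfolding g[OF p] E_def of_real_frame by (rule of_real_coframe_null_form)
  qed (use M s sc in \<open>auto intro: smooth_on_const smooth_on_add smooth_on_mult smooth_on_differentiable\<close>)
  then have T: "hyperkaehler_triple (smooth_on M) M (\<lambda>p. map_matrix ?c (dKP_metric u p))
    (\<lambda>p. map_matrix ?c (F p) ** QI ** map_matrix ?c (E p))
    (\<lambda>p. map_matrix ?c (F p) ** QJ ** map_matrix ?c (E p))
    (\<lambda>p. map_matrix ?c (F p) ** QK ** map_matrix ?c (E p))"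
    unfolding of_real_frame E_def F_def .
  have EF: "E p ** F p = mat 1" if "p \<in> M" for p
    unfolding E_def F_def by (rule coframe_frame[OF a[OF that]])
  have sym: "transpose (dKP_metric u p) = dKP_metric u p" if "p \<in> M" for p
    unfolding g[OF that] E_def by (rule transpose_coframe_null_form[OF a[OF that]])
  have neut: "neutral_signature (dKP_metric u p)" if "p \<in> M" for p
    unfolding g[OF that] by (rule neutral_signature_coframe[OF EF[OF that]])
  show ?thesis
    unfolding hyperkaehler_real_def M_def[symmetric]
    using M sg sym neut T conj_real_imag by blast
qed

theorem hyperkaehler_hol_dKP:
  assumes U: "open U" and u: "hol_on U u" and dKP: "dKP_solution U u"
    and nz: "\<forall>p\<in>U. pd 1 u p \<noteq> 0"
  shows "hyperkaehler_hol (base -` U) (dKP_metric u)"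
proof -
  define M where "M = base -` U"
  define f a b z where "f p = u (base p)" and "a p = pd 1 u (base p)" and "b p = pd 2 u (base p)"
    and "z p = p $ 4" for p :: "complex ^ 4"
  define E F where "E p = coframe (f p) (a p) (b p) (z p)" and "F p = frame (f p) (a p) (b p) (z p)" for p
  have M: "open M" unfolding M_def by (rule open_vimage_base[OF U])
  have a: "a p \<noteq> 0" if "p \<in> M" for p using nz that by (simp add: a_def M_def)
  have g: "dKP_metric u p = transpose (E p) ** null_form ** E p" if "p \<in> M" for p
    using dKP_metric_eq[of u p] a[OF that] by (simp add: a_def E_def f_def b_def z_def Let_def)
  have s: "hol_on M f" "hol_on M a" "hol_on M b" "hol_on M z"
    unfolding f_def[abs_def] a_def[abs_def] b_def[abs_def] z_def[abs_def] M_def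
    using hol_on_compose_base u hol_on_pd[OF U u] hol_on_nth by blast+
  have si: "hol_on M (\<lambda>p. inverse (a p))"
    by (rule hol_on_inverse[OF s(2) a])
  have sg: "hol_on M (\<lambda>p. dKP_metric u p $ i $ j)" for i j
  proof (rule hol_on_cong[OF M])
    show "dKP_metric u p $ i $ j = (transpose (E p) ** null_form ** E p) $ i $ j" if "p \<in> M" for p
      by (simp add: g[OF that])
    show "hol_on M (\<lambda>p. (transpose (E p) ** null_form ** E p) $ i $ j)"
      unfolding E_def
      by (rule metric_entries_closed[of "hol_on M"])
        (simp_all add: hol_on_const hol_on_add hol_on_mult s si)
  qed
  have d: "u differentiable at (base p)" "pd i u differentiable at (base p)" if "p \<in> M" for p i
    using that hol_on_differentiable[OF u] hol_on_differentiable[OF hol_on_pd[OF U u]]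
    by (auto simp: M_def)
  note pd_base = pd_compose_base[OF d(1)] pd_compose_base[OF d(2)]
  have T: "hyperkaehler_triple (hol_on M) M (dKP_metric u)
    (\<lambda>p. F p ** QI ** E p) (\<lambda>p. F p ** QJ ** E p) (\<lambda>p. F p ** QK ** E p)"
    unfolding E_def F_def
  proof (rule hyperkaehler_tripleI[OF M])
    fix p assume p: "p \<in> M"
    then have pU: "base p \<in> U" by (simp add: M_def)
    show "a p \<noteq> 0" by (rule a[OF p])
    show "pd i z p = (if i = 4 then 1 else 0)" for i
      by (simp add: z_def[abs_def] pd_nth)
    show "pd 1 f p = a p" "pd 2 f p = b p" "pd 4 f p = 0" "pd 4 a p = 0" "pd 4 b p = 0"
      by (simp_all add: f_def[abs_def] a_def[abs_def] b_def[abs_def] pd_base p)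
    have "pd 1 (pd 2 u) (base p) = pd 2 (pd 1 u) (base p)"
      using hol_on_differentiable[OF u] hol_on_differentiable[OF hol_on_pd[OF U u]] pU
      by (intro pd_commute[OF U pU]) auto
    then show "pd 1 b p = pd 2 a p"
      by (simp add: a_def[abs_def] b_def[abs_def] pd_base p)
    have "pd 3 (pd 1 u) (base p) = pd 1 u (base p) * pd 1 u (base p) +
        u (base p) * pd 1 (pd 1 u) (base p) + pd 2 (pd 2 u) (base p)"
      using hol_on_differentiable[OF u] hol_on_differentiable[OF hol_on_pd[OF U u]]
      by (intro pd_dKP[OF U pU _ _ dKP]) auto
    then show "pd 3 a p = a p * a p + f p * pd 1 a p + pd 2 b p"
      by (simp add: a_def[abs_def] b_def[abs_def] f_def pd_base p)
    show "dKP_metric u p = transpose (coframe (f p) (a p) (b p) (z p)) ** null_form **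
        coframe (f p) (a p) (b p) (z p)"
      unfolding g[OF p] E_def ..
  qed (use s si in \<open>auto intro: hol_on_const hol_on_add hol_on_mult hol_on_differentiable\<close>)
  have EF: "E p ** F p = mat 1" if "p \<in> M" for p
    unfolding E_def F_def by (rule coframe_frame[OF a[OF that]])
  have sym: "transpose (dKP_metric u p) = dKP_metric u p" if "p \<in> M" for p
    unfolding g[OF that] E_def by (rule transpose_coframe_null_form[OF a[OF that]])
  have nondeg: "invertible (dKP_metric u p)" if "p \<in> M" for p
    unfolding g[OF that] by (rule invertible_coframe[OF EF[OF that]])
  show ?thesis
    unfolding hyperkaehler_hol_def M_def[symmetric]
    using M sg sym nondeg T by blast
qed

theorem proposition2p7:
  fixes U :: "(real ^ 3) set" and u :: "real ^ 3 \<Rightarrow> real"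
    and V :: "(complex ^ 3) set" and v :: "complex ^ 3 \<Rightarrow> complex"
  shows
    "(open U \<and> smooth_on U u \<and> dKP_solution U u \<and> (\<forall>p\<in>U. pd 1 u p \<noteq> 0)
        \<longrightarrow> hyperkaehler_real (base -` U) (dKP_metric u)) \<and>
     (open V \<and> hol_on V v \<and> dKP_solution V v \<and> (\<forall>p\<in>V. pd 1 v p \<noteq> 0)
        \<longrightarrow> hyperkaehler_hol (base -` V) (dKP_metric v))"
  using hyperkaehler_real_dKP hyperkaehler_hol_dKP by blast

end
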